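(* Let $\rho>1/2$ be real and let $\mu\in\mathbb{C}$ satisfy $\operatorname{Re}\mu<1+1/\rho$. Let the functions $K_{\rho,\mu}(r,\varphi_1,\varphi_2,z)$, $K_{\rho,\mu}(r,\varphi,z)$, $K'_{\rho,\mu}(r,\varphi,z)$ and $P'_{\rho,\mu}(\tau,\psi,k,z)$ be as defined in the context. Then the following integral representations of the Mittag-Leffler function $E_{\rho,\mu}$ are valid. (1) For any real $\delta_{1\rho},\delta_{2\rho}$ satisfying $$\frac{\pi}{2\rho}<\delta_{1\rho}\leqslant\frac{\pi}{\rho},\quad \frac{\pi}{2\rho}<\delta_{2\rho}\leqslant\frac{\pi}{\rho}\quad\text{if }\rho>1,$$ $$\frac{\pi}{2\rho}<\delta_{1\rho}<\pi,\quad \frac{\pi}{2\rho}<\delta_{2\rho}<\pi\quad\text{if }1/2<\rho\leqslant1,$$ and any complex $z$ satisfying $\frac{\pi}{2\rho}-\delta_{2\rho}+\pi<\arg z<-\frac{\pi}{2\rho}+\delta_{1\rho}+\pi$, $$E_{\rho,\mu}(z)=\int_{0}^{\infty}K_{\rho,\mu}(r,-\delta_{1\rho},\delta_{2\rho},z)\,dr.$$ (2) If $1/2<\rho\leqslant1$, $\delta_{1\rho}=\pi$ and $\frac{\pi}{2\rho}<\delta_{2\rho}<\pi$, then for any complex $z$ satisfying $\frac{\pi}{2\rho}-\delta_{2\rho}+\pi<\arg z<-\frac{\pi}{2\rho}+2\pi$ and any real $\varepsilon_1$ with $0<\varepsilon_1<1$, $$E_{\rho,\mu}(z)=\int_{0}^{\infty}K'_{\rho,\mu}(r,\delta_{2\rho},z)\,dr-\int_{0}^{1-\varepsilon_1}K'_{\rho,\mu}(r,-\pi,z)\,dr-\int_{1+\varepsilon_1}^{\infty}K'_{\rho,\mu}(r,-\pi,z)\,dr+\int_{-2\pi}^{-\pi}P'_{\rho,\mu}(\varepsilon_1,\psi,-2,z)\,d\psi.$$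 (3) If $1/2<\rho\leqslant1$, $\frac{\pi}{2\rho}<\delta_{1\rho}<\pi$ and $\delta_{2\rho}=\pi$, then for any complex $z$ satisfying $\frac{\pi}{2\rho}<\arg z<-\frac{\pi}{2\rho}+\delta_{1\rho}+\pi$ and any real $\varepsilon_1$ with $0<\varepsilon_1<1$, $$E_{\rho,\mu}(z)=\int_{0}^{1-\varepsilon_1}K'_{\rho,\mu}(r,\pi,z)\,dr+\int_{1+\varepsilon_1}^{\infty}K'_{\rho,\mu}(r,\pi,z)\,dr+\int_{-\pi}^{0}P'_{\rho,\mu}(\varepsilon_1,\psi,0,z)\,d\psi-\int_{0}^{\infty}K'_{\rho,\mu}(r,-\delta_{1\rho},z)\,dr.$$ (4) If $1/2<\rho\leqslant1$ and $\delta_{1\rho}=\delta_{2\rho}=\pi$, then for any complex $z$ satisfying $\frac{\pi}{2\rho}<\arg z<-\frac{\pi}{2\rho}+2\pi$ and any real $\varepsilon_1$ with $0<\varepsilon_1<1$, $$E_{\rho,\mu}(z)=\int_{0}^{1-\varepsilon_1}K_{\rho,\mu}(r,\pi,z)\,dr+\int_{1+\varepsilon_1}^{\infty}K_{\rho,\mu}(r,\pi,z)\,dr+\int_{-\pi}^{0}P'_{\rho,\mu}(\varepsilon_1,\psi,0,z)\,d\psi+\int_{-2\pi}^{-\pi}P'_{\rho,\mu}(\varepsilon_1,\psi,-2,z)\,d\psi.$$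
   Context: The two-parameter Mittag-Leffler function is the entire function of $z$ defined, for real $\rho>0$ and $\mu\in\mathbb{C}$, by $E_{\rho,\mu}(z)=\sum_{k=0}^{\infty}\frac{z^k}{\Gamma(\mu+k/\rho)}$, where $1/\Gamma$ is taken to be $0$ at the poles of $\Gamma$. Convention on powers: $z\neq0$ is written $z=|z|e^{i\arg z}$ with $\arg z$ the value of the argument lying in the interval prescribed in the hypothesis (this interval is contained in $(0,2\pi)$), and for $r>0$ and $a\in\mathbb{C}$, $(zr)^{a}=\exp\{a(\ln(|z|r)+i\arg z)\}$ and $(zre^{-i\pi})^{a}=(zr)^{a}e^{-i\pi a}$. Definitions. Put $$\eta(r,\varphi,z)=(zr)^{\rho}e^{-i\rho\pi}\sin(\rho\varphi)+\rho(1-\mu)\varphi,$$ $$A_{\rho,\mu}(r,\omega_1,\omega_2,z)=\exp\left\{(zr)^\rho e^{-i\rho\pi}\cos(\rho\omega_1)\right\}(r^2+2r\cos\omega_2+1)\,e^{i\eta(r,\omega_1,z)}\left[r+e^{i\omega_1}\right].$$ The four-argument kernel is $$K_{\rho,\mu}(r,\varphi_1,\varphi_2,z)=\frac{\rho}{2\pi i}\,\frac{(zr)^{\rho(1-\mu)}e^{-i\rho\pi(1-\mu)}\left[A_{\rho,\mu}(r,\varphi_2,\varphi_1,z)-A_{\rho,\mu}(r,\varphi_1,\varphi_2,z)\right]}{(r^2+2r\cos\varphi_1+1)(r^2+2r\cos\varphi_2+1)}.$$ The three-argument kernel is $$K_{\rho,\mu}(r,\varphi,z)=\frac{\rho}{\pi}(zre^{-i\pi})^{\rho(1-\mu)}\exp\left\{(zre^{-i\pi})^\rho\cos(\rho\varphi)\right\}\frac{r\sin(\eta(r,\varphi,z))+\sin(\eta(r,\varphi,z)+\varphi)}{r^2+2r\cos\varphi+1}.$$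 Further, $$K'_{\rho,\mu}(r,\varphi,z)=\frac{\rho}{2\pi i}\,\frac{\exp\left\{(zr)^\rho e^{-i\pi\rho}\cos(\rho\varphi)\right\}}{r^2+2r\cos\varphi+1}(zr)^{\rho(1-\mu)}e^{i[\eta(r,\varphi,z)-\pi\rho(1-\mu)]}\left(r+e^{i\varphi}\right),$$ $$P'_{\rho,\mu}(\tau,\psi,k,z)=\frac{\rho\tau}{2\pi}\,\frac{\exp\left\{(z\,r(\tau,\psi))^\rho\cos(\rho\varphi(\tau,\psi,k))\right\}}{(r(\tau,\psi))^2-2r(\tau,\psi)\cos(\varphi(\tau,\psi,k))+1}\,(z\,r(\tau,\psi))^{\rho(1-\mu)}e^{i[\chi'(\tau,\psi,k,z)+\psi]}\left(r(\tau,\psi)e^{-i\varphi(\tau,\psi,k)}-1\right),$$ where $$\chi'(\tau,\psi,k,z)=(z\,r(\tau,\psi))^\rho\sin(\rho\varphi(\tau,\psi,k))+\rho(1-\mu)\varphi(\tau,\psi,k),$$ $$r(\tau,\psi)=\sqrt{\tau^2+2\tau\cos\psi+1},\qquad \varphi(\tau,\psi,k)=\arctan\left(\frac{\tau\sin\psi}{\tau\cos\psi+1}\right)+k\pi,$$ and $\arctan$ is the principal branch. *)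

theory Defs
  imports "HOL-Analysis.Analysis"
begin

(* rGamma = 1/Gamma, extended by 0 at the poles of Gamma *)
definition mittag_leffler :: "real \<Rightarrow> complex \<Rightarrow> complex \<Rightarrow> complex" where
  "mittag_leffler \<rho> \<mu> z = (\<Sum>k. z ^ k * rGamma (\<mu> + of_real (real k / \<rho>)))"

(* (z r)^a for z \<noteq> 0, r > 0.  The argument of z is the one in [0, 2 pi), not the principal
   value: every interval prescribed for arg z lies in (0, 2 pi).  Hence powr cannot be used. *)
definition zpow :: "complex \<Rightarrow> real \<Rightarrow> complex \<Rightarrow> complex" where
  "zpow z r a = exp (a * (of_real (ln (cmod z * r)) + \<i> * of_real (Arg2pi z)))"

(* (z r e^(-i pi))^a *)
definition zpow_rot :: "complex \<Rightarrow> real \<Rightarrow> complex \<Rightarrow> complex" where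
  "zpow_rot z r a = zpow z r a * exp (- \<i> * of_real pi * a)"

definition ml_eta :: "real \<Rightarrow> complex \<Rightarrow> real \<Rightarrow> real \<Rightarrow> complex \<Rightarrow> complex" where
  "ml_eta \<rho> \<mu> r \<phi> z =
     zpow z r (of_real \<rho>) * exp (- \<i> * of_real (\<rho> * pi)) * of_real (sin (\<rho> * \<phi>))
     + of_real \<rho> * (1 - \<mu>) * of_real \<phi>"

definition ml_A :: "real \<Rightarrow> complex \<Rightarrow> real \<Rightarrow> real \<Rightarrow> real \<Rightarrow> complex \<Rightarrow> complex" where
  "ml_A \<rho> \<mu> r \<omega>1 \<omega>2 z =
     exp (zpow z r (of_real \<rho>) * exp (- \<i> * of_real (\<rho> * pi)) * of_real (cos (\<rho> * \<omega>1)))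
     * of_real (r\<^sup>2 + 2 * r * cos \<omega>2 + 1)
     * exp (\<i> * ml_eta \<rho> \<mu> r \<omega>1 z)
     * (of_real r + exp (\<i> * of_real \<omega>1))"

definition ml_K4 :: "real \<Rightarrow> complex \<Rightarrow> real \<Rightarrow> real \<Rightarrow> real \<Rightarrow> complex \<Rightarrow> complex" where
  "ml_K4 \<rho> \<mu> r \<phi>1 \<phi>2 z =
     of_real \<rho> / (2 * of_real pi * \<i>)
     * (zpow z r (of_real \<rho> * (1 - \<mu>)) * exp (- \<i> * of_real (\<rho> * pi) * (1 - \<mu>))
        * (ml_A \<rho> \<mu> r \<phi>2 \<phi>1 z - ml_A \<rho> \<mu> r \<phi>1 \<phi>2 z))
     / of_real ((r\<^sup>2 + 2 * r * cos \<phi>1 + 1) * (r\<^sup>2 + 2 * r * cos \<phi>2 + 1))"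

definition ml_K3 :: "real \<Rightarrow> complex \<Rightarrow> real \<Rightarrow> real \<Rightarrow> complex \<Rightarrow> complex" where
  "ml_K3 \<rho> \<mu> r \<phi> z =
     of_real (\<rho> / pi) * zpow_rot z r (of_real \<rho> * (1 - \<mu>))
     * exp (zpow_rot z r (of_real \<rho>) * of_real (cos (\<rho> * \<phi>)))
     * (of_real r * sin (ml_eta \<rho> \<mu> r \<phi> z) + sin (ml_eta \<rho> \<mu> r \<phi> z + of_real \<phi>))
     / of_real (r\<^sup>2 + 2 * r * cos \<phi> + 1)"

definition ml_K' :: "real \<Rightarrow> complex \<Rightarrow> real \<Rightarrow> real \<Rightarrow> complex \<Rightarrow> complex" where
  "ml_K' \<rho> \<mu> r \<phi> z =
     of_real \<rho> / (2 * of_real pi * \<i>)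
     * (exp (zpow z r (of_real \<rho>) * exp (- \<i> * of_real (pi * \<rho>)) * of_real (cos (\<rho> * \<phi>)))
        / of_real (r\<^sup>2 + 2 * r * cos \<phi> + 1))
     * zpow z r (of_real \<rho> * (1 - \<mu>))
     * exp (\<i> * (ml_eta \<rho> \<mu> r \<phi> z - of_real (pi * \<rho>) * (1 - \<mu>)))
     * (of_real r + exp (\<i> * of_real \<phi>))"

definition arc_radius :: "real \<Rightarrow> real \<Rightarrow> real" where
  "arc_radius \<tau> \<psi> = sqrt (\<tau>\<^sup>2 + 2 * \<tau> * cos \<psi> + 1)"

definition arc_angle :: "real \<Rightarrow> real \<Rightarrow> int \<Rightarrow> real" where
  "arc_angle \<tau> \<psi> k = arctan (\<tau> * sin \<psi> / (\<tau> * cos \<psi> + 1)) + of_int k * pi"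

definition ml_chi' :: "real \<Rightarrow> complex \<Rightarrow> real \<Rightarrow> real \<Rightarrow> int \<Rightarrow> complex \<Rightarrow> complex" where
  "ml_chi' \<rho> \<mu> \<tau> \<psi> k z =
     zpow z (arc_radius \<tau> \<psi>) (of_real \<rho>) * of_real (sin (\<rho> * arc_angle \<tau> \<psi> k))
     + of_real \<rho> * (1 - \<mu>) * of_real (arc_angle \<tau> \<psi> k)"

definition ml_P' :: "real \<Rightarrow> complex \<Rightarrow> real \<Rightarrow> real \<Rightarrow> int \<Rightarrow> complex \<Rightarrow> complex" where
  "ml_P' \<rho> \<mu> \<tau> \<psi> k z =
     of_real (\<rho> * \<tau> / (2 * pi))
     * (exp (zpow z (arc_radius \<tau> \<psi>) (of_real \<rho>) * of_real (cos (\<rho> * arc_angle \<tau> \<psi> k)))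
        / of_real ((arc_radius \<tau> \<psi>)\<^sup>2 - 2 * arc_radius \<tau> \<psi> * cos (arc_angle \<tau> \<psi> k) + 1))
     * zpow z (arc_radius \<tau> \<psi>) (of_real \<rho> * (1 - \<mu>))
     * exp (\<i> * (ml_chi' \<rho> \<mu> \<tau> \<psi> k z + of_real \<psi>))
     * (of_real (arc_radius \<tau> \<psi>) * exp (- \<i> * of_real (arc_angle \<tau> \<psi> k)) - 1)"

end

theory Submission
  imports Defs "HOL-Complex_Analysis.Cauchy_Integral_Theorem" "HOL-Real_Asymp.Real_Asymp"
begin

text \<open>
  All four integral representations are one contour integral in disguise. On the logarithmic
  coordinate \<open>s\<close> with \<open>\<zeta> = exp s\<close>, the kernels \<open>K'\<close> and \<open>P'\<close> are
  \<open>\<rho> / (2 \<pi> \<i>)\<close> times the pullback (and each \<open>K\<close> is a difference of two \<open>K'\<close>) of the single meromorphic form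
  \<open>exp (exp (\<rho> s)) exp (\<rho> (1 - \<mu>) s) exp s / (exp s - z) ds\<close>: rays from the origin become horizontal
  lines, and the half circles around \<open>\<zeta> = z\<close> become arcs around the simple poles \<open>log z + 2 \<pi> \<i> n\<close>.
  The logarithmic coordinate also settles the choice of branches, because all powers become entire.

  All the contours lie in the plane cut along two vertical rays, one from \<open>log z\<close> upwards and one from
  \<open>log z - 2 \<pi> \<i>\<close> downwards. This domain is starlike and contains no pole, so the form has a primitive
  \<open>\<Phi>\<close> there (\<open>ml_form_has_primitive\<close>). Hence Cauchy's theorem never has to be applied to a particular
  contour: every integral is a difference of values or limits of \<open>\<Phi>\<close>, and the different
  representations merely pass through different intermediate points, at which the values cancel.
  Three limits remain. As \<open>Re s \<longrightarrow> -\<infinity>\<close> the limit does not depend on the line; this is where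
  \<open>Re \<mu> < 1 + 1 / \<rho>\<close> is needed. As \<open>Re s \<longrightarrow> \<infinity>\<close> on a line \<open>Im s = y\<close> with \<open>cos (\<rho> y) < 0\<close>, the double
  exponential decays, and the limit is constant on each of the two strips
  \<open>\<pi>/2 < \<rho> y < 3\<pi>/2\<close> and \<open>-3\<pi>/2 < \<rho> y < -\<pi>/2\<close>. The hypotheses on \<open>arg z\<close> place the upper and
  the lower line of each contour in these strips.

  So the theorem comes down to identifying the difference of the last two limits with
  \<open>2 \<pi> \<i> / \<rho>\<close> times the Mittag-Leffler function (\<open>mittag_leffler_sums_jump\<close>). Far to the right,
  \<open>exp s / (exp s - z)\<close> is a geometric series in \<open>z exp (- s)\<close>, with a remainder that is uniformly
  small on a three-sided contour, and each term is Hankel's loop integral for the reciprocal Gamma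
  function (\<open>hankel_jump_tendsto_rGamma\<close>). Hankel's formula itself is obtained from Euler's integral and
  the reflection formula when \<open>Re a < 1\<close>, and is carried to all \<open>a\<close> by the functional equation; only
  the step from \<open>a = 0\<close> to \<open>a = 1\<close> divides by zero, and there the \<open>2 \<pi> \<i>\<close>-periodicity of the integrand
  gives the value directly.
\<close>

section \<open>Improper integrals and limits of primitives\<close>

text \<open>
  The gauge integral needs no absolute convergence at an improper end point: convergence of the
  primitive is enough, here and in the next two lemmas. Therefore no kernel has to be bounded again
  once the limits of its primitive are known.
\<close>
lemma has_integral_FTC_at_top:
  fixes F f :: "real \<Rightarrow> 'a::banach"
  assumes der: "\<And>x. x \<ge> c \<Longrightarrow> (F has_vector_derivative f x) (at x)"
    and lim: "(F \<longlongrightarrow> L) at_top"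
  shows "(f has_integral (L - F c)) {c..}"
proof -
  have "\<exists>B>0. \<forall>a b. ball 0 B \<subseteq> cbox a b \<longrightarrow>
      (\<exists>v. ((\<lambda>x. if x \<in> {c..} then f x else 0) has_integral v) (cbox a b) \<and> norm (v - (L - F c)) < e)"
    if "e > 0" for e
  proof -
    obtain N where N: "\<And>x. x \<ge> N \<Longrightarrow> dist (F x) L < e"
      using tendstoD[OF lim \<open>e > 0\<close>] by (auto simp: eventually_at_top_linorder)
    \<comment> \<open>The ball of this radius contains \<open>N\<close> and \<open>c\<close>, so every interval containing it has its right end beyond \<open>N\<close>.\<close>
    define B where "B = max \<bar>N\<bar> \<bar>c\<bar> + 1"
    have "\<exists>v. ((\<lambda>x. if x \<in> {c..} then f x else 0) has_integral v) (cbox a b) \<and> norm (v - (L - F c)) < e"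
      if sub: "ball 0 B \<subseteq> cbox a b" for a b
    proof -
      have mem: "x \<in> {a..b}" if "\<bar>x\<bar> < B" for x
        using sub that by (auto simp: subset_iff)
      have "a \<le> c" "c \<le> b" "N \<le> b"
        using mem[of c] mem[of "max N c"] mem[of "-\<bar>c\<bar>"] unfolding B_def by auto
      have "(f has_integral (F b - F c)) {c..b}"
        by (rule fundamental_theorem_of_calculus)
          (use der \<open>c \<le> b\<close> in \<open>auto intro: has_vector_derivative_at_within\<close>)
      moreover have "{c..} \<inter> cbox a b = {c..b}"
        using \<open>a \<le> c\<close> by auto
      ultimately have "((\<lambda>x. if x \<in> {c..} then f x else 0) has_integral (F b - F c)) (cbox a b)"
        by (simp only: has_integral_restrict_Int)
      moreover have "norm ((F b - F c) - (L - F c)) < e"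
        using N[OF \<open>N \<le> b\<close>] by (simp add: dist_norm)
      ultimately show ?thesis by blast
    qed
    moreover have "B > 0" by (auto simp: B_def)
    ultimately show ?thesis by blast
  qed
  then show ?thesis
    by (subst has_integral') auto
qed

lemma has_integral_FTC_at_right_0:
  fixes F f :: "real \<Rightarrow> 'a::banach"
  assumes "0 < c"
    and der: "\<And>x. 0 < x \<Longrightarrow> x \<le> c \<Longrightarrow> (F has_vector_derivative f x) (at x)"
    and lim: "(F \<longlongrightarrow> L) (at_right 0)"
  shows "(f has_integral (F c - L)) {0<..c}"
proof -
  define F0 where "F0 x = (if x = 0 then L else F x)" for x
  have ev: "\<forall>\<^sub>F x in at_right 0. F x = F0 x"
    by (simp add: F0_def eventually_at_filter)
  have "isCont F x" if "0 < x" "x \<le> c" for x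
    using der[OF that] by (simp add: has_derivative_continuous has_vector_derivative_def)
  have "continuous_on {0..c} F0"
    unfolding continuous_on_def
  proof
    fix x assume x: "x \<in> {0..c}"
    show "(F0 \<longlongrightarrow> F0 x) (at x within {0..c})"
    proof (cases "x = 0")
      case True
      have "(F0 \<longlongrightarrow> L) (at_right 0)"
        using lim tendsto_cong[OF ev, of L] by simp
      then have "(F0 \<longlongrightarrow> L) (at 0 within {0..c})"
        using \<open>0 < c\<close> by (simp add: at_within_Icc_at_right)
      then show ?thesis
        using True by (simp add: F0_def)
    next
      case False
      have "\<forall>\<^sub>F y in at x within {0..c}. y \<noteq> 0"
        using False by (intro eventually_neq_at_within)
      then have ev': "\<forall>\<^sub>F y in at x within {0..c}. F y = F0 y"
        by eventually_elim (simp add: F0_def)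
      have "(F \<longlongrightarrow> F x) (at x within {0..c})"
        using False x \<open>\<lbrakk>0 < x; x \<le> c\<rbrakk> \<Longrightarrow> isCont F x\<close>
        by (simp add: isCont_def tendsto_within_subset[where S=UNIV])
      then show ?thesis
        using False tendsto_cong[OF ev', of "F x"] by (simp add: F0_def[of x])
    qed
  qed
  moreover have "(F0 has_vector_derivative f x) (at x)" if "x \<in> {0<..<c}" for x
  proof (rule has_vector_derivative_transform_within_open)
    show "(F has_vector_derivative f x) (at x)"
      using der that by auto
    show "open {0::real<..}" "x \<in> {0<..}" using that by auto
  qed (auto simp: F0_def)
  ultimately have "(f has_integral (F0 c - F0 0)) {0..c}"
    using \<open>0 < c\<close> by (intro fundamental_theorem_of_calculus_interior) auto
  then have "(f has_integral (F c - L)) {0..c}"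
    using \<open>0 < c\<close> by (simp add: F0_def)
  moreover have "(f has_integral (F c - L)) {0<..c} \<longleftrightarrow> (f has_integral (F c - L)) {0..c}"
    by (rule has_integral_spike_set_eq)
      (auto intro!: negligible_subset[OF negligible_sing[of "0::real"]])
  ultimately show ?thesis by simp
qed

lemma has_integral_FTC_0_infinity:
  fixes F f :: "real \<Rightarrow> 'a::banach"
  assumes der: "\<And>x. 0 < x \<Longrightarrow> (F has_vector_derivative f x) (at x)"
    and lim0: "(F \<longlongrightarrow> L0) (at_right 0)" and lim: "(F \<longlongrightarrow> L) at_top"
  shows "(f has_integral (L - L0)) {0<..}"
proof -
  have "(f has_integral (F 1 - L0)) {0<..1}"
    by (rule has_integral_FTC_at_right_0[OF _ der lim0]) auto
  moreover have "(f has_integral (L - F 1)) {1..}"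
    by (rule has_integral_FTC_at_top[OF der lim]) auto
  ultimately have "(f has_integral ((F 1 - L0) + (L - F 1))) ({0<..1} \<union> {1..})"
    by (rule has_integral_Un) (auto intro: negligible_subset[OF negligible_sing[of "1::real"]])
  moreover have "{0<..1} \<union> {1..} = {0::real<..}" by auto
  ultimately show ?thesis by (simp add: algebra_simps)
qed

text \<open>Comparison with the primitive \<open>- (B / p) exp (- p x)\<close> of the bound.\<close>
lemma increment_bound_exp:
  fixes F :: "real \<Rightarrow> 'a::real_normed_vector"
  assumes "p > 0" "B \<ge> 0"
    and der: "\<And>x. x \<ge> X \<Longrightarrow> (F has_vector_derivative f x) (at x)"
    and bnd: "\<And>x. x \<ge> X \<Longrightarrow> norm (f x) \<le> B * exp (- p * x)"
    and "X \<le> a" "a \<le> b"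
  shows "norm (F b - F a) \<le> B / p * exp (- p * a)"
proof (cases "a < b")
  case False
  then show ?thesis using assms by simp
next
  case True
  define \<phi> where "\<phi> x = - (B / p) * exp (- p * x)" for x
  have \<phi>: "(\<phi> has_real_derivative B * exp (- p * x)) (at x)" for x
    unfolding \<phi>_def using \<open>p > 0\<close> by (auto intro!: derivative_eq_intros)
  have "norm (F b - F a) \<le> \<phi> b - \<phi> a"
  proof (rule differentiable_bound_general[OF True, where f'=f])
    show "continuous_on {a..b} F"
      using \<open>X \<le> a\<close>
      by (intro continuous_at_imp_continuous_on ballI has_vector_derivative_continuous[OF der]) simp
    show "continuous_on {a..b} \<phi>"
      using \<open>p > 0\<close> by (auto simp: \<phi>_def intro!: continuous_intros)
    show "(\<phi> has_vector_derivative B * exp (- p * x)) (at x)" for x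
      using \<phi> by (simp add: has_real_derivative_iff_has_vector_derivative)
  qed (use der bnd \<open>X \<le> a\<close> in auto)
  also have "\<dots> \<le> B / p * exp (- p * a)"
    using \<open>p > 0\<close> \<open>B \<ge> 0\<close> by (simp add: \<phi>_def)
  finally show ?thesis .
qed

lemma tendsto_at_top_if_increment_bound:
  fixes F :: "real \<Rightarrow> 'a::banach"
  assumes inc: "\<And>a b. X \<le> a \<Longrightarrow> a \<le> b \<Longrightarrow> norm (F b - F a) \<le> \<beta> a"
    and \<beta>: "(\<beta> \<longlongrightarrow> 0) at_top"
  shows "\<exists>L. (F \<longlongrightarrow> L) at_top"
proof -
  have "cauchy_filter (filtermap F at_top)"
    unfolding cauchy_filter_metric_filtermap
  proof (intro allI impI)
    fix e :: real assume "e > 0"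
    then have "\<forall>\<^sub>F a in at_top. \<beta> a < e / 2 \<and> X \<le> a"
      using \<beta> by (intro eventually_conj eventually_ge_at_top order_tendstoD(2)[OF \<beta>]) auto
    then obtain a where a: "\<beta> a < e / 2" "X \<le> a"
      by (auto simp: eventually_at_top_linorder)
    have "dist (F x) (F y) < e" if "x \<ge> a" "y \<ge> a" for x y
    proof -
      have "dist (F x) (F y) \<le> norm (F x - F a) + norm (F y - F a)"
        by (metis dist_norm dist_triangle2)
      also have "\<dots> < e"
        using inc[OF a(2) that(1)] inc[OF a(2) that(2)] a(1) by linarith
      finally show ?thesis .
    qed
    then show "\<exists>P. eventually P at_top \<and> (\<forall>x y. P x \<and> P y \<longrightarrow> dist (F x) (F y) < e)"
      by (intro exI[of _ "\<lambda>x. x \<ge> a"]) (auto intro: eventually_ge_at_top)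
  qed
  moreover have "filtermap F at_top \<noteq> bot"
    by (simp add: filtermap_bot_iff)
  ultimately show ?thesis
    using complete_uniform[where S="UNIV :: 'a set"] complete_UNIV
    by (force simp: filterlim_def)
qed

lemma has_vector_derivative_Complex_line:
  assumes "(F has_field_derivative D) (at (Complex x y))"
  shows "((\<lambda>t. F (Complex t y)) has_vector_derivative D) (at x)"
proof -
  have "((\<lambda>t. complex_of_real t + \<i> * of_real y) has_vector_derivative 1) (at x)"
    by (auto intro!: derivative_eq_intros)
  then have "((\<lambda>t. Complex t y) has_vector_derivative 1) (at x)"
    by (simp add: Complex_eq)
  from field_vector_diff_chain_at[OF this assms] show ?thesis
    by (simp add: o_def)
qed

lemma vertical_increment_bound:
  fixes F f :: "complex \<Rightarrow> complex"
  assumes "ya \<le> yb"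
    and der: "\<And>y. y \<in> {ya..yb} \<Longrightarrow> (F has_field_derivative f (Complex x y)) (at (Complex x y))"
    and bnd: "\<And>y. y \<in> {ya..yb} \<Longrightarrow> norm (f (Complex x y)) \<le> B"
  shows "norm (F (Complex x yb) - F (Complex x ya)) \<le> B * (yb - ya)"
proof -
  define V where "V = {s. Re s \<ge> x} \<inter> {s. Re s \<le> x} \<inter> {s. Im s \<ge> ya} \<inter> {s. Im s \<le> yb}"
  have V: "(F has_field_derivative f s) (at s within V) \<and> norm (f s) \<le> B" if "s \<in> V" for s
  proof -
    have "s = Complex x (Im s)" "Im s \<in> {ya..yb}"
      using that by (auto simp: V_def complex_eq_iff)
    then show ?thesis
      using der[of "Im s"] bnd[of "Im s"] by (auto intro: has_field_derivative_at_within)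
  qed
  have "convex V"
    unfolding V_def by (intro convex_Int convex_halfspace_Re_ge convex_halfspace_Re_le
        convex_halfspace_Im_ge convex_halfspace_Im_le)
  then have "norm (F (Complex x yb) - F (Complex x ya)) \<le> B * norm (Complex x yb - Complex x ya)"
    by (rule field_differentiable_bound[where f'=f])
      (use \<open>ya \<le> yb\<close> V in \<open>auto simp: V_def\<close>)
  also have "norm (Complex x yb - Complex x ya) = yb - ya"
    using \<open>ya \<le> yb\<close> by (simp add: cmod_def)
  finally show ?thesis .
qed

text \<open>
  Exponential decay along one line makes the primitive converge there. Two lines lead to the
  same limit because they are joined by vertical segments of fixed length, on which the derivative
  tends to zero. The bounds may depend on the compact subinterval, since in the application they
  degenerate at the ends of \<open>I\<close>.
\<close>
lemma primitive_limit_on_lines_at_top: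
  fixes F f :: "complex \<Rightarrow> complex"
  assumes "is_interval I"
    and decay: "\<And>ya yb. ya \<in> I \<Longrightarrow> yb \<in> I \<Longrightarrow> ya \<le> yb \<Longrightarrow>
       \<exists>X B p. p > 0 \<and> (\<forall>x\<ge>X. \<forall>y\<in>{ya..yb}.
          (F has_field_derivative f (Complex x y)) (at (Complex x y)) \<and>
          norm (f (Complex x y)) \<le> B * exp (- p * x))"
  shows "\<exists>L. \<forall>y\<in>I. ((\<lambda>x. F (Complex x y)) \<longlongrightarrow> L) at_top"
proof (cases "I = {}")
  case True
  then show ?thesis by simp
next
  case False
  have null: "((\<lambda>x. B * exp (- p * x)) \<longlongrightarrow> 0) at_top" if "p > 0" for B p :: real
  proof -
    have "filterlim (\<lambda>x. p * x) at_top at_top"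
      using that by (intro filterlim_tendsto_pos_mult_at_top[OF tendsto_const]) (auto intro: filterlim_ident)
    then have "((\<lambda>x. exp (- (p * x))) \<longlongrightarrow> 0) at_top"
      by (intro filterlim_compose[OF exp_at_bot] filterlim_compose[OF filterlim_uminus_at_bot_at_top])
    from tendsto_mult_right_zero[OF this, of B] show ?thesis by simp
  qed
  have ex: "\<exists>L. ((\<lambda>x. F (Complex x y)) \<longlongrightarrow> L) at_top" if y: "y \<in> I" for y
  proof -
    obtain X B p where p: "p > 0" and
      *: "\<And>x. x \<ge> X \<Longrightarrow> (F has_field_derivative f (Complex x y)) (at (Complex x y)) \<and>
          norm (f (Complex x y)) \<le> B * exp (- p * x)"
      using decay[OF y y order_refl] by (metis atLeastAtMost_iff order_refl)
    have "0 \<le> B * exp (- p * X)" by (rule order_trans[OF norm_ge_zero]) (use *[of X] in blast)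
    then have "B \<ge> 0" by (simp add: zero_le_mult_iff)
    show ?thesis
    proof (rule tendsto_at_top_if_increment_bound)
      fix a b assume "X \<le> a" "a \<le> b"
      then show "norm (F (Complex b y) - F (Complex a y)) \<le> B / p * exp (- p * a)"
        using * p \<open>B \<ge> 0\<close>
        by (intro increment_bound_exp[where f="\<lambda>x. f (Complex x y)"]) (auto intro: has_vector_derivative_Complex_line)
    qed (rule null[OF p])
  qed
  have same: "((\<lambda>x. F (Complex x yb) - F (Complex x ya)) \<longlongrightarrow> 0) at_top"
    if y: "ya \<in> I" "yb \<in> I" "ya \<le> yb" for ya yb
  proof -
    obtain X B p where p: "p > 0" and
      *: "\<And>x y. x \<ge> X \<Longrightarrow> y \<in> {ya..yb} \<Longrightarrow>
          (F has_field_derivative f (Complex x y)) (at (Complex x y)) \<and>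
          norm (f (Complex x y)) \<le> B * exp (- p * x)"
      using decay[OF y] by metis
    have "norm (F (Complex x yb) - F (Complex x ya)) \<le> B * (yb - ya) * exp (- p * x)" if "x \<ge> X" for x
    proof -
      have "norm (F (Complex x yb) - F (Complex x ya)) \<le> (B * exp (- p * x)) * (yb - ya)"
        using * that by (intro vertical_increment_bound[OF y(3), of F f]) blast+
      then show ?thesis by (simp only: mult_ac)
    qed
    then show ?thesis
      by (intro Lim_null_comparison[OF _ null[OF p, of "B * (yb - ya)"]])
        (auto simp: eventually_at_top_linorder)
  qed
  obtain y0 where "y0 \<in> I" using False by auto
  with ex obtain L where L: "((\<lambda>x. F (Complex x y0)) \<longlongrightarrow> L) at_top" by blast
  have "((\<lambda>x. F (Complex x y)) \<longlongrightarrow> L) at_top" if "y \<in> I" for y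
  proof -
    have "((\<lambda>x. F (Complex x y) - F (Complex x y0)) \<longlongrightarrow> 0) at_top"
    \<comment> \<open>The comparison of two lines is stated for ordered heights only.\<close>
    proof (cases "y0 \<le> y")
      case False
      then show ?thesis
        using tendsto_minus[OF same[of y y0]] that \<open>y0 \<in> I\<close> by simp
    qed (use same[of y0 y] that \<open>y0 \<in> I\<close> in simp)
    from tendsto_add[OF this L] show ?thesis by simp
  qed
  then show ?thesis by blast
qed

text \<open>The reflection \<open>s \<mapsto> - s\<close> reduces this to the previous lemma.\<close>
lemma primitive_limit_on_lines_at_bot:
  fixes F f :: "complex \<Rightarrow> complex"
  assumes decay: "\<And>ya yb. ya \<le> yb \<Longrightarrow>
       \<exists>X B p. p > 0 \<and> (\<forall>x\<le>X. \<forall>y\<in>{ya..yb}.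
          (F has_field_derivative f (Complex x y)) (at (Complex x y)) \<and>
          norm (f (Complex x y)) \<le> B * exp (p * x))"
  shows "\<exists>L. \<forall>y. ((\<lambda>x. F (Complex x y)) \<longlongrightarrow> L) at_bot"
proof -
  define F' where "F' s = F (- s)" for s
  have der: "(F' has_field_derivative - f (- s)) (at s)" if "(F has_field_derivative f (- s)) (at (- s))" for s
  proof -
    have "(uminus has_field_derivative -1) (at s)"
      by (auto intro!: derivative_eq_intros)
    from DERIV_chain2[OF that this] show ?thesis
      by (simp add: F'_def[abs_def])
  qed
  have "\<exists>L. \<forall>y\<in>UNIV. ((\<lambda>x. F' (Complex x y)) \<longlongrightarrow> L) at_top"
  proof (rule primitive_limit_on_lines_at_top[where f="\<lambda>s. - f (- s)"])
    fix ya yb :: real assume "ya \<le> yb"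
    have "- yb \<le> - ya" using \<open>ya \<le> yb\<close> by simp
    from decay[OF this] obtain X B p where p: "p > 0" and
      *: "\<forall>x\<le>X. \<forall>y\<in>{- yb..- ya}.
          (F has_field_derivative f (Complex x y)) (at (Complex x y)) \<and>
          norm (f (Complex x y)) \<le> B * exp (p * x)"
      by (elim exE conjE)
    have neg: "- Complex x y = Complex (- x) (- y)" for x y
      by (simp add: complex_eq_iff)
    have step: "(F' has_field_derivative - f (- Complex x y)) (at (Complex x y)) \<and>
          norm (- f (- Complex x y)) \<le> B * exp (- p * x)" if "x \<ge> - X" "y \<in> {ya..yb}" for x y
    proof 
      have d: "(F has_field_derivative f (Complex (- x) (- y))) (at (Complex (- x) (- y)))"
       and b: "norm (f (Complex (- x) (- y))) \<le> B * exp (p * (- x))"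
        using *[rule_format, of "- x" "- y"] that by simp_all
      show "(F' has_field_derivative - f (- Complex x y)) (at (Complex x y))"
        using d by (intro der) (simp only: neg)
      show "norm (- f (- Complex x y)) \<le> B * exp (- p * x)"
        using b by (simp only: neg norm_minus_cancel mult_minus_left mult_minus_right)
    qed
    show "\<exists>X B p. p > 0 \<and> (\<forall>x\<ge>X. \<forall>y\<in>{ya..yb}.
          (F' has_field_derivative - f (- Complex x y)) (at (Complex x y)) \<and>
          norm (- f (- Complex x y)) \<le> B * exp (- p * x))"
      by (rule exI[of _ "- X"], rule exI[of _ B], rule exI[of _ p])
        (intro conjI[OF p] allI impI ballI step; assumption)
  qed (rule is_interval_univ)
  then obtain L where L: "\<And>y. ((\<lambda>x. F' (Complex x y)) \<longlongrightarrow> L) at_top" by blast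
  have "((\<lambda>x. F (Complex x y)) \<longlongrightarrow> L) at_bot" for y
  proof -
    have "((\<lambda>x. F' (Complex (- x) (- y))) \<longlongrightarrow> L) at_bot"
      by (rule filterlim_compose[OF L[of "- y"] filterlim_uminus_at_top_at_bot])
    moreover have "F' (Complex (- x) (- y)) = F (Complex x y)" for x
      unfolding F'_def by (rule arg_cong[of _ _ F]) (simp add: complex_eq_iff)
    ultimately show ?thesis by (simp only:)
  qed
  then show ?thesis by blast
qed

section \<open>Hankel's integral for the reciprocal Gamma function\<close>
lemma exp_dominates_affine:
  fixes c \<rho> q M :: real
  assumes "c > 0" "\<rho> > 0"
  shows "\<forall>\<^sub>F x in at_top. - c * exp (\<rho> * x) + q * x + M \<le> - x"
proof -
  have "((\<lambda>x. (q + 1) * (x * exp (- \<rho> * x)) + M * exp (- \<rho> * x)) \<longlongrightarrow> (q + 1) * 0 + M * 0) at_top"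
    using assms by (intro tendsto_intros) real_asymp+
  then have "\<forall>\<^sub>F x in at_top. (q + 1) * (x * exp (- \<rho> * x)) + M * exp (- \<rho> * x) < c"
    using \<open>c > 0\<close> by (intro order_tendstoD(2)) auto
  then show ?thesis
  proof eventually_elim
    case (elim x)
    then have "((q + 1) * x + M) * exp (- \<rho> * x) * exp (\<rho> * x) < c * exp (\<rho> * x)"
      by (intro mult_strict_right_mono) (auto simp: algebra_simps)
    then show ?case by (simp add: exp_minus algebra_simps)
  qed
qed

text \<open>
  This is the integrand \<open>e\<^sup>t t\<^sup>-\<^sup>a dt\<close> of Hankel's loop integral in the coordinate \<open>t = exp u\<close>. In it the
  loop around the negative axis runs along the lines \<open>Im u = - \<pi>\<close> and \<open>Im u = \<pi>\<close>, and the jump of a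
  primitive between these lines, far to the right, is the whole loop integral.
\<close>
definition hankel :: "complex \<Rightarrow> complex \<Rightarrow> complex" where
  "hankel a u = exp (exp u) * exp ((1 - a) * u)"

lemma norm_hankel:
  "norm (hankel a (Complex x y)) = exp (exp x * cos y + (1 - Re a) * x + Im a * y)"
  by (simp add: hankel_def norm_mult Re_exp algebra_simps flip: exp_add)

lemma norm_hankel_le:
  "norm (hankel a (Complex x y)) \<le> exp (exp x + (1 - Re a) * x + \<bar>Im a\<bar> * \<bar>y\<bar>)"
proof -
  have "exp x * cos y \<le> exp x * 1"
    by (intro mult_left_mono) auto
  moreover have "Im a * y \<le> \<bar>Im a\<bar> * \<bar>y\<bar>"
    by (metis abs_ge_self abs_mult)
  ultimately show ?thesis
    unfolding norm_hankel exp_le_cancel_iff by linarith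
qed

lemma holomorphic_on_hankel [holomorphic_intros]:
  "f holomorphic_on S \<Longrightarrow> (\<lambda>s. hankel a (f s)) holomorphic_on S"
  unfolding hankel_def by (intro holomorphic_intros)

text \<open>
  Where \<open>cos y\<close> is negative, the modulus is governed by \<open>exp (cos y exp x)\<close>, which beats every
  exponential in \<open>x\<close>; compactness bounds \<open>cos y\<close> away from \<open>0\<close>.
\<close>
lemma hankel_decay:
  assumes "ya \<le> yb" "\<And>y. y \<in> {ya..yb} \<Longrightarrow> cos y < 0"
  shows "\<exists>X. \<forall>x\<ge>X. \<forall>y\<in>{ya..yb}. norm (hankel a (Complex x y)) \<le> exp (- x)"
proof -
  have "{ya..yb} \<noteq> {}" using \<open>ya \<le> yb\<close> by simp
  from continuous_attains_sup[OF compact_Icc this continuous_on_cos[OF continuous_on_id]]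
  obtain ym where ym: "ym \<in> {ya..yb}" "\<And>y. y \<in> {ya..yb} \<Longrightarrow> cos y \<le> cos ym"
    by blast
  define M where "M = \<bar>Im a\<bar> * max \<bar>ya\<bar> \<bar>yb\<bar>"
  have "\<forall>\<^sub>F x in at_top. - (- cos ym) * exp (1 * x) + (1 - Re a) * x + M \<le> - x"
    using assms(2)[OF ym(1)] by (intro exp_dominates_affine) auto
  then obtain X where X: "\<And>x. x \<ge> X \<Longrightarrow> cos ym * exp x + (1 - Re a) * x + M \<le> - x"
    by (auto simp: eventually_at_top_linorder)
  have "norm (hankel a (Complex x y)) \<le> exp (- x)" if "x \<ge> X" "y \<in> {ya..yb}" for x y
  proof -
    have "exp x * cos y \<le> cos ym * exp x"
      using mult_right_mono[OF ym(2)[OF that(2)], of "exp x"] by (simp add: mult_ac)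
    moreover have "Im a * y \<le> \<bar>Im a\<bar> * \<bar>y\<bar>"
      by (metis abs_ge_self abs_mult)
    moreover have "\<dots> \<le> M"
      unfolding M_def using that(2) by (intro mult_left_mono) auto
    ultimately show ?thesis
      using X[OF that(1)] unfolding norm_hankel exp_le_cancel_iff by linarith
  qed
  then show ?thesis by blast
qed

lemma hankel_has_primitive:
  obtains P where "\<And>u. (P has_field_derivative hankel a u) (at u)"
  using holomorphic_convex_primitive'[of UNIV "hankel a"] holomorphic_on_hankel[of "\<lambda>u. u"]
  by (auto simp: hankel_def intro: holomorphic_intros)

text \<open>
  For \<open>Re a < 1\<close> the loop can be shrunk onto the negative axis: the jump vanishes as \<open>x \<longrightarrow> -\<infinity>\<close>, and
  its derivative is \<open>2 \<i> sin (\<pi> a)\<close> times Euler's integrand for \<open>Gamma (1 - a)\<close> at \<open>w = exp x\<close>. The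
  reflection formula then turns \<open>2 \<i> sin (\<pi> a) Gamma (1 - a)\<close> into \<open>2 \<pi> \<i> rGamma a\<close>.
\<close>
lemma hankel_jump_tendsto_rGamma_Re_less_1:
  assumes P: "\<And>u. (P has_field_derivative hankel a u) (at u)" and "Re a < 1"
  shows "((\<lambda>x. P (Complex x pi) - P (Complex x (- pi))) \<longlongrightarrow> 2 * pi * \<i> * rGamma a) at_top"
proof -
  define D where "D x = P (Complex x pi) - P (Complex x (- pi))" for x
  define c where "c = 2 * \<i> * sin (of_real pi * a)"
  define f where "f w = c * (complex_of_real w powr ((1 - a) - 1) / of_real (exp w))" for w :: real
  have D_deriv: "((\<lambda>w. D (ln w)) has_vector_derivative f w) (at w)" if "w > 0" for w
  proof -
    have line: "hankel a (Complex (ln w) y) = of_real (exp (w * cos y)) * (of_real w * of_real w powr (- a)) * exp ((1 - a) * (\<i> * of_real y))"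
      if "sin y = 0" for y
    proof -
      have "exp (Complex (ln w) y) = of_real (w * cos y)"
        using \<open>w > 0\<close> that by (simp add: complex_eq_iff Re_exp Im_exp)
      moreover have "(1 - a) * Complex (ln w) y = of_real (ln w) + - a * of_real (ln w) + (1 - a) * (\<i> * of_real y)"
        by (simp add: complex_eq_iff algebra_simps)
      moreover have "exp (complex_of_real (ln w)) = of_real w"
        using \<open>w > 0\<close> by (simp add: exp_of_real)
      moreover have "exp (- a * of_real (ln w)) = complex_of_real w powr (- a)"
        using \<open>w > 0\<close> by (simp add: powr_def Ln_of_real)
      ultimately show ?thesis
        unfolding hankel_def by (simp only: exp_add) (simp only: exp_of_real mult.assoc)
    qed
    have "exp (\<i> * (of_real pi * (1 - a))) - exp (- (\<i> * (of_real pi * (1 - a)))) = 2 * \<i> * sin (of_real pi * (1 - a))"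
      by (simp add: sin_exp_eq field_simps)
    also have "sin (of_real pi * (1 - a)) = sin (of_real pi * a)"
      by (simp add: right_diff_distrib sin_diff flip: sin_of_real cos_of_real)
    finally have c: "exp ((1 - a) * (\<i> * of_real pi)) - exp ((1 - a) * (\<i> * of_real (- pi))) = c"
      by (simp add: c_def mult_ac)
    have "(D has_vector_derivative (hankel a (Complex (ln w) pi) - hankel a (Complex (ln w) (- pi)))) (at (ln w))"
      unfolding D_def by (intro has_vector_derivative_diff has_vector_derivative_Complex_line P)
    moreover have "(ln has_vector_derivative (1 / w)) (at w)"
      using that by (auto intro!: derivative_eq_intros simp flip: has_real_derivative_iff_has_vector_derivative)
    ultimately have "((D \<circ> ln) has_vector_derivative ((1 / w) *\<^sub>R (hankel a (Complex (ln w) pi) - hankel a (Complex (ln w) (- pi))))) (at w)"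
      by (intro vector_diff_chain_at)
    also have "(1 / w) *\<^sub>R (hankel a (Complex (ln w) pi) - hankel a (Complex (ln w) (- pi)))
       = of_real (exp (- w)) * of_real w powr (- a) * (exp ((1 - a) * (\<i> * of_real pi)) - exp ((1 - a) * (\<i> * of_real (- pi))))"
      using that by (subst (1 2) line) (simp_all add: scaleR_conv_of_real field_simps)
    also have "\<dots> = f w"
      unfolding c f_def by (simp add: exp_minus field_simps)
    finally show ?thesis by (simp add: o_def)
  qed
  have "(D \<longlongrightarrow> 0) at_bot"
  proof (rule Lim_null_comparison)
    have "norm (D x) \<le> exp (exp x + (1 - Re a) * x + \<bar>Im a\<bar> * pi) * (pi - - pi)" for x
      unfolding D_def
    proof (rule vertical_increment_bound[OF _ P])
      fix y assume y: "y \<in> {- pi..pi}"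
      have "\<bar>Im a\<bar> * \<bar>y\<bar> \<le> \<bar>Im a\<bar> * pi"
        using y by (intro mult_left_mono) auto
      then show "norm (hankel a (Complex x y)) \<le> exp (exp x + (1 - Re a) * x + \<bar>Im a\<bar> * pi)"
        by (intro order_trans[OF norm_hankel_le]) simp
    qed auto
    then show "\<forall>\<^sub>F x in at_bot. norm (D x) \<le> exp (exp x + (1 - Re a) * x + \<bar>Im a\<bar> * pi) * (pi - - pi)"
      by simp
    show "((\<lambda>x. exp (exp x + (1 - Re a) * x + \<bar>Im a\<bar> * pi) * (pi - - pi)) \<longlongrightarrow> 0) at_bot"
      using \<open>Re a < 1\<close> by real_asymp
  qed
  then have lim0: "((\<lambda>w. D (ln w)) \<longlongrightarrow> 0) (at_right 0)"
    by (rule filterlim_compose[OF _ ln_at_0])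
  have "\<exists>L. ((\<lambda>x. P (Complex x y)) \<longlongrightarrow> L) at_top" if cos: "cos y < 0" for y
  proof -
    have "\<exists>L. \<forall>y\<in>{y}. ((\<lambda>x. P (Complex x y)) \<longlongrightarrow> L) at_top"
    proof (rule primitive_limit_on_lines_at_top)
      fix ya yb assume y: "ya \<in> {y}" "yb \<in> {y}" "ya \<le> yb"
      then obtain X where "\<forall>x\<ge>X. \<forall>y\<in>{ya..yb}. norm (hankel a (Complex x y)) \<le> exp (- x)"
        using hankel_decay[of ya yb a] cos by auto
      then show "\<exists>X B p. p > 0 \<and> (\<forall>x\<ge>X. \<forall>y\<in>{ya..yb}.
          (P has_field_derivative hankel a (Complex x y)) (at (Complex x y)) \<and>
          norm (hankel a (Complex x y)) \<le> B * exp (- p * x))"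
        by (intro exI[of _ X] exI[of _ 1] exI[of _ "1::real"]) (auto simp: P)
    qed (auto simp: is_interval_1)
    then show ?thesis by simp
  qed
  from this[of pi] this[of "- pi"] obtain Lp Lm where
    "((\<lambda>x. P (Complex x pi)) \<longlongrightarrow> Lp) at_top" "((\<lambda>x. P (Complex x (- pi))) \<longlongrightarrow> Lm) at_top"
    by auto
  then have "(D \<longlongrightarrow> Lp - Lm) at_top"
    unfolding D_def by (intro tendsto_diff)
  then obtain L where L: "(D \<longlongrightarrow> L) at_top" ..
  have int_L: "(f has_integral (L - 0)) {0<..}"
    by (rule has_integral_FTC_0_infinity[OF D_deriv lim0 filterlim_compose[OF L ln_at_top]])
  have int_Gamma: "(f has_integral (c * Gamma (1 - a))) {0<..}"
    unfolding f_def using \<open>Re a < 1\<close> by (intro has_integral_mult_right Gamma_integral_complex') auto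
  have "L = c * Gamma (1 - a)"
    using has_integral_unique[OF int_L int_Gamma] by simp
  also have "\<dots> = 2 * pi * \<i> * (rGamma a * (rGamma (1 - a) * Gamma (1 - a)))"
    using rGamma_reflection_complex[of a] by (simp add: c_def field_simps)
  also have "rGamma (1 - a) * Gamma (1 - a) = 1"
  proof -
    have "1 - a \<notin> \<int>\<^sub>\<le>\<^sub>0"
      using \<open>Re a < 1\<close> by (auto elim!: nonpos_Ints_cases simp: complex_eq_iff)
    then show ?thesis by (simp add: Gamma_def rGamma_eq_zero_iff)
  qed
  finally show ?thesis
    using L by (simp add: D_def[abs_def])
qed

text \<open>
  For \<open>a = 1\<close> the integrand \<open>exp (exp u)\<close> is \<open>2 \<pi> \<i>\<close>-periodic, so the jump does not depend on \<open>x\<close>. Far to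
  the left the integrand is close to \<open>1\<close>, and the jump is close to that of the identity.
\<close>
lemma hankel_jump_tendsto_rGamma_1:
  assumes P: "\<And>u. (P has_field_derivative hankel 1 u) (at u)"
  shows "((\<lambda>x. P (Complex x pi) - P (Complex x (- pi))) \<longlongrightarrow> 2 * pi * \<i> * rGamma 1) at_top"
proof -
  define J where "J u = P (u + 2 * of_real pi * \<i>) - P u" for u
  have "(J has_field_derivative 0) (at u)" for u
  proof -
    have "((\<lambda>u. P (u + 2 * of_real pi * \<i>)) has_field_derivative hankel 1 (u + 2 * of_real pi * \<i>)) (at u)"
      using P[of "u + 2 * of_real pi * \<i>"] by (simp add: DERIV_shift)
    moreover have "hankel 1 (u + 2 * of_real pi * \<i>) = hankel 1 u"
      by (simp add: hankel_def exp_add exp_two_pi_i' mult_ac)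
    ultimately show ?thesis
      unfolding J_def using DERIV_diff[OF _ P[of u]] by fastforce
  qed
  then obtain C where C: "\<And>u. J u = C"
    using has_field_derivative_zero_constant[of UNIV J] by auto
  have jump: "P (Complex x pi) - P (Complex x (- pi)) = C" for x
  proof -
    have "Complex x (- pi) + 2 * of_real pi * \<i> = Complex x pi"
      by (simp add: complex_eq_iff)
    then show ?thesis using C[of "Complex x (- pi)"] by (simp add: J_def)
  qed
  have bound: "norm (C - 2 * pi * \<i>) \<le> exp (exp x) * exp x * (2 * pi)" for x :: real
  proof -
    \<comment> \<open>The derivative \<open>exp (exp u) - 1\<close> is of order \<open>exp x\<close>, which forces the constant to be \<open>2 \<pi> \<i>\<close>.\<close>
    define Q where "Q u = P u - u" for u
    have "norm (Q (Complex x pi) - Q (Complex x (- pi))) \<le> exp (exp x) * exp x * (pi - - pi)"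
    proof (rule vertical_increment_bound[where f="\<lambda>u. hankel 1 u - 1"])
      show "(Q has_field_derivative hankel 1 u - 1) (at u)" for u
        unfolding Q_def by (intro DERIV_diff P DERIV_ident)
      fix y
      define v where "v = exp (Complex x y)"
      have v: "norm v = exp x" by (simp add: v_def)
      have "norm (exp v - 1) \<le> exp \<bar>Re v\<bar> * norm v"
        using Taylor_exp[of v 0] by simp
      also have "\<dots> \<le> exp (exp x) * exp x"
        using abs_Re_le_cmod[of v] by (intro mult_mono) (auto simp: v)
      finally show "norm (hankel 1 (Complex x y) - 1) \<le> exp (exp x) * exp x"
        by (simp add: hankel_def v_def)
    qed auto
    moreover have "Q (Complex x pi) - Q (Complex x (- pi)) = C - 2 * pi * \<i>"
      using jump[of x] by (auto simp: Q_def complex_eq_iff algebra_simps)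
    ultimately show ?thesis by simp
  qed
  have "((\<lambda>x::real. exp (exp x) * exp x * (2 * pi)) \<longlongrightarrow> 0) at_bot"
    by real_asymp
  then have "norm (C - 2 * pi * \<i>) \<le> 0"
    by (rule tendsto_lowerbound) (use bound in auto)
  then show ?thesis unfolding jump by simp
qed

text \<open>
  Integration by parts: \<open>hankel (a + 1)\<close> has derivative \<open>hankel a - a hankel (a + 1)\<close> and vanishes at the
  far ends of the two lines, so the jumps satisfy the functional equation of \<open>rGamma\<close>.
\<close>
lemma hankel_jump_tendsto_rGamma_plus_1:
  assumes P: "\<And>u. (P has_field_derivative hankel (a + 1) u) (at u)" and "a \<noteq> 0"
    and lim: "\<And>Q. (\<And>u. (Q has_field_derivative hankel a u) (at u)) \<Longrightarrow>
      ((\<lambda>x. Q (Complex x pi) - Q (Complex x (- pi))) \<longlongrightarrow> 2 * pi * \<i> * rGamma a) at_top"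
  shows "((\<lambda>x. P (Complex x pi) - P (Complex x (- pi))) \<longlongrightarrow> 2 * pi * \<i> * rGamma (a + 1)) at_top"
proof -
  define Q where "Q u = a * P u + hankel (a + 1) u" for u
  have "(Q has_field_derivative a * hankel (a + 1) u + (exp u * exp (exp u) * exp (- a * u) - a * hankel (a + 1) u)) (at u)" for u
    unfolding Q_def
    by (intro DERIV_add DERIV_cmult P)
      (auto simp: hankel_def intro!: derivative_eq_intros)
  moreover have "exp u * exp (exp u) * exp (- a * u) = hankel a u" for u
    by (simp add: hankel_def algebra_simps flip: exp_add)
  ultimately have "(Q has_field_derivative hankel a u) (at u)" for u
    by simp
  from lim[OF this] have Q: "((\<lambda>x. Q (Complex x pi) - Q (Complex x (- pi))) \<longlongrightarrow> 2 * pi * \<i> * rGamma a) at_top" .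
  have null: "((\<lambda>x. hankel (a + 1) (Complex x y)) \<longlongrightarrow> 0) at_top" if y: "cos y < 0" for y
  proof -
    obtain X where "\<And>x. x \<ge> X \<Longrightarrow> norm (hankel (a + 1) (Complex x y)) \<le> exp (- x)"
      using hankel_decay[of y y "a + 1"] y by auto
    then have "\<forall>\<^sub>F x in at_top. norm (hankel (a + 1) (Complex x y)) \<le> exp (- x)"
      by (auto simp: eventually_at_top_linorder)
    then show ?thesis
      by (rule Lim_null_comparison) real_asymp
  qed
  have "((\<lambda>x. ((Q (Complex x pi) - Q (Complex x (- pi)))
      - (hankel (a + 1) (Complex x pi) - hankel (a + 1) (Complex x (- pi)))) / a)
    \<longlongrightarrow> (2 * pi * \<i> * rGamma a - (0 - 0)) / a) at_top"
    using \<open>a \<noteq> 0\<close> by (intro tendsto_intros Q null) auto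
  moreover have "(2 * pi * \<i> * rGamma a - (0 - 0)) / a = 2 * pi * \<i> * rGamma (a + 1)"
    using \<open>a \<noteq> 0\<close> rGamma_plus1[of a] by (simp add: field_simps)
  ultimately show ?thesis
    using \<open>a \<noteq> 0\<close> by (simp add: Q_def diff_divide_distrib add_divide_distrib)
qed

lemma hankel_jump_tendsto_rGamma:
  assumes P: "\<And>u. (P has_field_derivative hankel a u) (at u)"
  shows "((\<lambda>x. P (Complex x pi) - P (Complex x (- pi))) \<longlongrightarrow> 2 * pi * \<i> * rGamma a) at_top"
proof -
  have "((\<lambda>x. P (Complex x pi) - P (Complex x (- pi))) \<longlongrightarrow> 2 * pi * \<i> * rGamma a) at_top"
    if "Re a < 1 + real n" and "\<And>u. (P has_field_derivative hankel a u) (at u)" for n a P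
    using that
  proof (induction n arbitrary: a P)
    case 0
    then show ?case by (intro hankel_jump_tendsto_rGamma_Re_less_1) auto
  next
    case (Suc n)
    show ?case
    proof (cases "a = 1")
      case True
      then show ?thesis using hankel_jump_tendsto_rGamma_1 Suc.prems(2) by simp
    next
      case False
      have "Re (a - 1) < 1 + real n" using Suc.prems(1) by simp
      note IH = Suc.IH[OF this]
      show ?thesis
        using hankel_jump_tendsto_rGamma_plus_1[of P "a - 1"] IH Suc.prems(2) False by simp
    qed
  qed
  moreover have "Re a < 1 + real (nat \<lceil>Re a\<rceil>)" by linarith
  ultimately show ?thesis using P by blast
qed

section \<open>The Mittag-Leffler form on the cut logarithmic plane\<close>

text \<open>
  The poles \<open>log z + 2 \<pi> \<i> n\<close> all lie on the line \<open>Re s = ln (cmod z)\<close>. Keeping only the open segment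
  between the two poles with \<open>arg\<close> equal to \<open>Arg2pi z - 2 \<pi>\<close> and \<open>Arg2pi z\<close> removes all of them and leaves a
  domain that is starlike about the midpoint of this segment.
\<close>
definition cut_plane :: "complex \<Rightarrow> complex set" where
  "cut_plane z = {s. Re s = ln (cmod z) \<longrightarrow> Arg2pi z - 2 * pi < Im s \<and> Im s < Arg2pi z}"

lemma open_cut_plane: "open (cut_plane z)"
proof -
  have "closed (({s. Re s = ln (cmod z)} \<inter> {s. Im s \<le> Arg2pi z - 2 * pi})
      \<union> ({s. Re s = ln (cmod z)} \<inter> {s. Im s \<ge> Arg2pi z}))"
    by (intro closed_Un closed_Int closed_halfspace_Re_eq closed_halfspace_Im_le closed_halfspace_Im_ge)
  moreover have "({s. Re s = ln (cmod z)} \<inter> {s. Im s \<le> Arg2pi z - 2 * pi})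
      \<union> ({s. Re s = ln (cmod z)} \<inter> {s. Im s \<ge> Arg2pi z}) = - cut_plane z"
    by (auto simp: cut_plane_def)
  ultimately show ?thesis by (simp add: closed_def)
qed

lemma starlike_cut_plane: "starlike (cut_plane z)"
  unfolding starlike_def
proof (intro bexI ballI)
  define a where "a = Complex (ln (cmod z)) (Arg2pi z - pi)"
  show "a \<in> cut_plane z" by (simp add: a_def cut_plane_def)
  fix s assume s: "s \<in> cut_plane z"
  show "closed_segment a s \<subseteq> cut_plane z"
  proof
    fix w assume "w \<in> closed_segment a s"
    then obtain t where t: "0 \<le> t" "t \<le> 1" "w = (1 - t) *\<^sub>R a + t *\<^sub>R s"
      by (auto simp: closed_segment_def)
    have "Arg2pi z - 2 * pi < Im w \<and> Im w < Arg2pi z" if "Re w = ln (cmod z)"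
    proof -
      have "t * (Re s - ln (cmod z)) = 0"
        using that t(3) by (simp add: a_def algebra_simps)
      then have "t = 0 \<or> Im s \<in> {Arg2pi z - 2 * pi<..<Arg2pi z}"
        using s by (auto simp: cut_plane_def)
      then show ?thesis
      proof
        assume "t = 0"
        then show ?thesis using t(3) by (simp add: a_def)
      next
        assume "Im s \<in> {Arg2pi z - 2 * pi<..<Arg2pi z}"
        moreover have "Im a \<in> {Arg2pi z - 2 * pi<..<Arg2pi z}"
          by (simp add: a_def)
        ultimately have "(1 - t) *\<^sub>R Im a + t *\<^sub>R Im s \<in> {Arg2pi z - 2 * pi<..<Arg2pi z}"
          using convexD[OF convex_real_interval(8), of "Im a" "Arg2pi z - 2 * pi" "Arg2pi z" "Im s" "1 - t" t] t by simp
        then show ?thesis using t(3) by simp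
      qed
    qed
    then show "w \<in> cut_plane z" by (simp add: cut_plane_def)
  qed
qed

lemma exp_ln_norm_Arg2pi: "z \<noteq> 0 \<Longrightarrow> exp (Complex (ln (cmod z)) (Arg2pi z)) = z"
  using Arg2pi_eq[of z] by (simp add: Complex_eq exp_add exp_of_real)

lemma exp_neq_on_cut_plane:
  assumes "z \<noteq> 0" "s \<in> cut_plane z"
  shows "exp s \<noteq> z"
proof
  assume "exp s = z"
  then have "exp (Re s) = cmod z" by (metis norm_exp_eq_Re)
  then have "Re s = ln (cmod z)" by (metis ln_exp)
  moreover have "exp s = exp (Complex (ln (cmod z)) (Arg2pi z))"
    using \<open>exp s = z\<close> exp_ln_norm_Arg2pi[OF assms(1)] by simp
  then obtain n :: int where "s = Complex (ln (cmod z)) (Arg2pi z) + (of_int (2 * n) * pi) * \<i>"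
    by (auto simp: exp_eq)
  then have "Im s = Arg2pi z + 2 * pi * of_int n" by simp
  ultimately have "- (2 * pi) < 2 * pi * of_int n" "2 * pi * of_int n < 0"
    using assms(2) by (auto simp: cut_plane_def)
  then have "2 * pi * (-1) < 2 * pi * of_int n" "of_int n < (0::real)"
    by (auto simp: mult_less_0_iff)
  then have "-1 < (of_int n :: real)" "of_int n < (0::real)"
    using mult_less_cancel_left_pos[of "2 * pi" "-1" "of_int n"] by auto
  then have "n < 0" by simp
  then have "of_int n \<le> (of_int (-1) :: real)"
    by (subst of_int_le_iff) simp
  then show False using \<open>-1 < (of_int n :: real)\<close> by simp
qed

text \<open>
  The coefficient of the classical contour integral
  \<open>exp (\<zeta>\<^sup>\<rho>) \<zeta>\<^bsup>\<rho> (1 - \<mu>)\<^esup> / (\<zeta> - z) d\<zeta>\<close> in the coordinate \<open>\<zeta> = exp s\<close>.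
\<close>
definition ml_form :: "real \<Rightarrow> complex \<Rightarrow> complex \<Rightarrow> complex \<Rightarrow> complex" where
  "ml_form \<rho> \<mu> z s = hankel \<mu> (of_real \<rho> * s) * (exp s / (exp s - z))"

lemma ml_form_has_primitive:
  assumes "z \<noteq> 0"
  obtains \<Phi> where "\<And>s. s \<in> cut_plane z \<Longrightarrow> (\<Phi> has_field_derivative ml_form \<rho> \<mu> z s) (at s)"
proof -
  have hol: "ml_form \<rho> \<mu> z holomorphic_on cut_plane z"
    unfolding ml_form_def using exp_neq_on_cut_plane[OF assms]
    by (intro holomorphic_intros) auto
  then have "\<exists>\<Phi>. \<forall>s\<in>cut_plane z. (\<Phi> has_field_derivative ml_form \<rho> \<mu> z s) (at s)"
    by (intro holomorphic_starlike_primitive[of _ _ "{}"] holomorphic_on_imp_continuous_on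
        starlike_cut_plane open_cut_plane)
      (auto intro: holomorphic_on_imp_differentiable_at open_cut_plane)
  then show ?thesis using that by blast
qed

lemma of_real_mult_Complex: "of_real \<rho> * Complex x y = Complex (\<rho> * x) (\<rho> * y)"
  by (simp add: complex_eq_iff)

lemma norm_ml_form_le_right:
  assumes "2 * cmod z \<le> exp x"
  shows "cmod (ml_form \<rho> \<mu> z (Complex x y)) \<le> 2 * cmod (hankel \<mu> (Complex (\<rho> * x) (\<rho> * y)))"
proof -
  define w where "w = exp (Complex x y)"
  have w: "cmod w = exp x" "w \<noteq> 0" by (simp_all add: w_def)
  have "cmod w - cmod z \<le> cmod (w - z)" by (rule norm_triangle_ineq2)
  then have "cmod w \<le> 2 * cmod (w - z)" "cmod (w - z) > 0"
    using assms w by (auto intro: less_le_trans[of 0 "exp x"] simp: dest: order_trans[of _ "exp x"])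
  then have "cmod (w / (w - z)) \<le> 2"
    by (simp add: norm_divide field_simps)
  then have "cmod (hankel \<mu> (Complex (\<rho> * x) (\<rho> * y))) * cmod (w / (w - z)) \<le> cmod (hankel \<mu> (Complex (\<rho> * x) (\<rho> * y))) * 2"
    by (intro mult_left_mono) auto
  then show ?thesis
    unfolding ml_form_def norm_mult of_real_mult_Complex w_def by (simp only: mult.commute)
qed

lemma right_of_cut:
  assumes "z \<noteq> 0" "2 * cmod z \<le> exp x"
  shows "Complex x y \<in> cut_plane z"
proof -
  have "0 < cmod z" using assms(1) by simp
  moreover from this have "cmod z < exp x" using assms(2) by linarith
  ultimately have "ln (cmod z) < x"
    using ln_less_cancel_iff[of "cmod z" "exp x"] by simp
  then show ?thesis by (simp add: cut_plane_def)
qed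

lemma ml_form_decay_at_top:
  assumes "\<rho> > 0" "z \<noteq> 0" "ya \<le> yb" "\<And>y. y \<in> {ya..yb} \<Longrightarrow> cos (\<rho> * y) < 0"
  shows "\<exists>X. \<forall>x\<ge>X. \<forall>y\<in>{ya..yb}. 2 * cmod z \<le> exp x \<and>
           cmod (ml_form \<rho> \<mu> z (Complex x y)) \<le> 2 * exp (- \<rho> * x)"
proof -
  have "cos y < 0" if "y \<in> {\<rho> * ya..\<rho> * yb}" for y
  proof -
    have "y / \<rho> \<in> {ya..yb}" using that \<open>\<rho> > 0\<close> by (simp add: field_simps)
    from assms(4)[OF this] show ?thesis using \<open>\<rho> > 0\<close> by simp
  qed
  moreover have "\<rho> * ya \<le> \<rho> * yb" using assms(1,3) by simp
  ultimately have "\<exists>X. \<forall>x\<ge>X. \<forall>y\<in>{\<rho> * ya..\<rho> * yb}. cmod (hankel \<mu> (Complex x y)) \<le> exp (- x)"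
    by (intro hankel_decay)
  then obtain X where X: "\<forall>x\<ge>X. \<forall>y\<in>{\<rho> * ya..\<rho> * yb}. cmod (hankel \<mu> (Complex x y)) \<le> exp (- x)" ..
  have "2 * cmod z \<le> exp x \<and> cmod (ml_form \<rho> \<mu> z (Complex x y)) \<le> 2 * exp (- \<rho> * x)"
    if "x \<ge> max (X / \<rho>) (ln (2 * cmod z))" "y \<in> {ya..yb}" for x y
  proof
    show z: "2 * cmod z \<le> exp x"
    proof -
      have "exp (ln (2 * cmod z)) \<le> exp x" using that(1) by simp
      then show ?thesis using \<open>z \<noteq> 0\<close> by simp
    qed
    have "cmod (hankel \<mu> (Complex (\<rho> * x) (\<rho> * y))) \<le> exp (- (\<rho> * x))"
    proof (rule X[rule_format])
      show "X \<le> \<rho> * x" using that(1) \<open>\<rho> > 0\<close> by (simp add: field_simps)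
      show "\<rho> * y \<in> {\<rho> * ya..\<rho> * yb}" using that(2) \<open>\<rho> > 0\<close> by simp
    qed
    then show "cmod (ml_form \<rho> \<mu> z (Complex x y)) \<le> 2 * exp (- \<rho> * x)"
      using norm_ml_form_le_right[OF z, of \<rho> \<mu> y] by simp
  qed
  then show ?thesis
    by (intro exI[of _ "max (X / \<rho>) (ln (2 * cmod z))"] allI impI ballI)
qed

lemma ml_primitive_limit_at_top:
  assumes "\<rho> > 0" "z \<noteq> 0" "is_interval I" "\<And>y. y \<in> I \<Longrightarrow> cos (\<rho> * y) < 0"
    and \<Phi>: "\<And>s. s \<in> cut_plane z \<Longrightarrow> (\<Phi> has_field_derivative ml_form \<rho> \<mu> z s) (at s)"
  shows "\<exists>L. \<forall>y\<in>I. ((\<lambda>x. \<Phi> (Complex x y)) \<longlongrightarrow> L) at_top"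
proof (rule primitive_limit_on_lines_at_top[OF assms(3)])
  fix ya yb assume y: "ya \<in> I" "yb \<in> I" "ya \<le> yb"
  have "cos (\<rho> * y) < 0" if "y \<in> {ya..yb}" for y
    using that mem_is_interval_1_I[OF assms(3) y(1,2)] by (intro assms(4)) simp
  from ml_form_decay_at_top[OF assms(1,2) y(3) this] obtain X where
    X: "\<forall>x\<ge>X. \<forall>y\<in>{ya..yb}. 2 * cmod z \<le> exp x \<and>
           cmod (ml_form \<rho> \<mu> z (Complex x y)) \<le> 2 * exp (- \<rho> * x)" ..
  have "\<forall>x\<ge>X. \<forall>y\<in>{ya..yb}.
          (\<Phi> has_field_derivative ml_form \<rho> \<mu> z (Complex x y)) (at (Complex x y)) \<and>
          norm (ml_form \<rho> \<mu> z (Complex x y)) \<le> 2 * exp (- \<rho> * x)"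
    using X by (simp add: \<Phi> right_of_cut \<open>z \<noteq> 0\<close>)
  with \<open>\<rho> > 0\<close> show "\<exists>X B p. p > 0 \<and> (\<forall>x\<ge>X. \<forall>y\<in>{ya..yb}.
          (\<Phi> has_field_derivative ml_form \<rho> \<mu> z (Complex x y)) (at (Complex x y)) \<and>
          norm (ml_form \<rho> \<mu> z (Complex x y)) \<le> B * exp (- p * x))"
    by (intro exI[of _ X] exI[of _ 2] exI[of _ \<rho>] conjI)
qed

text \<open>
  To the left the double exponential stays bounded and \<open>exp s / (exp s - z)\<close> is of order \<open>exp x\<close>, so the
  form decays like \<open>exp ((\<rho> (1 - Re \<mu>) + 1) x)\<close>; the bound on \<open>Re \<mu>\<close> makes this exponent positive.
\<close>
lemma ml_primitive_limit_at_bot: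
  assumes "\<rho> > 0" "z \<noteq> 0" "Re \<mu> < 1 + 1 / \<rho>"
    and \<Phi>: "\<And>s. s \<in> cut_plane z \<Longrightarrow> (\<Phi> has_field_derivative ml_form \<rho> \<mu> z s) (at s)"
  shows "\<exists>L. \<forall>y. ((\<lambda>x. \<Phi> (Complex x y)) \<longlongrightarrow> L) at_bot"
proof (rule primitive_limit_on_lines_at_bot)
  fix ya yb :: real assume "ya \<le> yb"
  define p where "p = \<rho> * (1 - Re \<mu>) + 1"
  have "\<rho> * Re \<mu> < \<rho> * (1 + 1 / \<rho>)"
    using assms(1,3) by (intro mult_strict_left_mono)
  then have "p > 0" using \<open>\<rho> > 0\<close> by (simp add: p_def algebra_simps)
  define M where "M = \<bar>Im \<mu>\<bar> * (\<rho> * max \<bar>ya\<bar> \<bar>yb\<bar>)"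
  define X where "X = min 0 (ln (cmod z / 2))"
  have "(\<Phi> has_field_derivative ml_form \<rho> \<mu> z (Complex x y)) (at (Complex x y)) \<and>
      cmod (ml_form \<rho> \<mu> z (Complex x y)) \<le> (exp (1 + M) * (2 / cmod z)) * exp (p * x)"
    if x: "x \<le> X" and y: "y \<in> {ya..yb}" for x y
  proof
    have small: "2 * exp x \<le> cmod z"
    proof -
      have "exp x \<le> exp (ln (cmod z / 2))" using x by (simp add: X_def)
      then show ?thesis using \<open>z \<noteq> 0\<close> by simp
    qed
    then have "exp x < cmod z" using exp_gt_zero[of x] by linarith
    then have "x \<noteq> ln (cmod z)" using \<open>z \<noteq> 0\<close> by auto
    then show "(\<Phi> has_field_derivative ml_form \<rho> \<mu> z (Complex x y)) (at (Complex x y))"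
      by (intro \<Phi>) (simp add: cut_plane_def)
    define w where "w = exp (Complex x y)"
    have w: "cmod w = exp x" by (simp add: w_def)
    have "cmod z - cmod w \<le> cmod (w - z)" by (metis norm_minus_commute norm_triangle_ineq2)
    then have "cmod z / 2 \<le> cmod (w - z)" using small w by linarith
    then have "cmod w / cmod (w - z) \<le> exp x / (cmod z / 2)"
      using w \<open>z \<noteq> 0\<close> by (intro frac_le) auto
    then have frac: "cmod (w / (w - z)) \<le> 2 / cmod z * exp x"
      by (simp add: norm_divide mult.commute)
    have "exp (\<rho> * x) \<le> 1" using x \<open>\<rho> > 0\<close> by (simp add: X_def mult_nonneg_nonpos)
    moreover have "\<bar>Im \<mu>\<bar> * \<bar>\<rho> * y\<bar> \<le> M"
      unfolding M_def using y \<open>\<rho> > 0\<close> by (intro mult_left_mono) (auto simp: abs_mult)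
    ultimately have "exp (exp (\<rho> * x) + (1 - Re \<mu>) * (\<rho> * x) + \<bar>Im \<mu>\<bar> * \<bar>\<rho> * y\<bar>)
       \<le> exp (1 + M + \<rho> * (1 - Re \<mu>) * x)"
      unfolding exp_le_cancel_iff mult.left_commute[of \<rho>] mult.assoc by linarith
    then have "cmod (hankel \<mu> (Complex (\<rho> * x) (\<rho> * y))) \<le> exp (1 + M + \<rho> * (1 - Re \<mu>) * x)"
      by (rule order_trans[OF norm_hankel_le])
    then have "cmod (hankel \<mu> (Complex (\<rho> * x) (\<rho> * y))) * cmod (w / (w - z))
       \<le> exp (1 + M + \<rho> * (1 - Re \<mu>) * x) * (2 / cmod z * exp x)"
      by (intro mult_mono frac) auto
    also have "\<dots> = (exp (1 + M) * (2 / cmod z)) * exp (p * x)"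
    proof -
      have "exp (1 + M + \<rho> * (1 - Re \<mu>) * x) * exp x = exp (1 + M) * exp (p * x)"
        by (simp add: p_def algebra_simps flip: exp_add)
      then show ?thesis by simp
    qed
    finally show "cmod (ml_form \<rho> \<mu> z (Complex x y)) \<le> (exp (1 + M) * (2 / cmod z)) * exp (p * x)"
      unfolding ml_form_def norm_mult of_real_mult_Complex w_def .
  qed
  then have "\<forall>x\<le>X. \<forall>y\<in>{ya..yb}.
          (\<Phi> has_field_derivative ml_form \<rho> \<mu> z (Complex x y)) (at (Complex x y)) \<and>
          norm (ml_form \<rho> \<mu> z (Complex x y)) \<le> exp (1 + M) * (2 / cmod z) * exp (p * x)"
    by (intro allI impI ballI)
  with \<open>p > 0\<close> show "\<exists>X B p. p > 0 \<and> (\<forall>x\<le>X. \<forall>y\<in>{ya..yb}.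
          (\<Phi> has_field_derivative ml_form \<rho> \<mu> z (Complex x y)) (at (Complex x y)) \<and>
          norm (ml_form \<rho> \<mu> z (Complex x y)) \<le> B * exp (p * x))"
    by (intro exI[of _ X] exI[of _ "exp (1 + M) * (2 / cmod z)"] exI[of _ p] conjI)
qed

text \<open>
  Multiplying \<open>hankel \<mu>\<close> at \<open>\<rho> s\<close> by \<open>exp (- k s)\<close> shifts its parameter to \<open>\<mu> + k / \<rho>\<close>. So the geometric
  series of \<open>exp s / (exp s - z)\<close> is a series of Hankel integrands, and the exponents are those of the
  Mittag-Leffler series.
\<close>
lemma ml_form_geometric_remainder:
  assumes "\<rho> \<noteq> 0" "exp s \<noteq> z"
  shows "ml_form \<rho> \<mu> z s - (\<Sum>k<N. z ^ k * hankel (\<mu> + of_real (real k / \<rho>)) (of_real \<rho> * s))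
       = ml_form \<rho> \<mu> z s * (z * exp (- s)) ^ N"
proof -
  define q where "q = z * exp (- s)"
  have "q \<noteq> 1" using assms(2) by (auto simp: q_def exp_minus field_simps)
  have frac: "exp s / (exp s - z) = 1 / (1 - q)"
    using assms(2) by (simp add: q_def exp_minus field_simps)
  have "z ^ k * hankel (\<mu> + of_real (real k / \<rho>)) (of_real \<rho> * s) = hankel \<mu> (of_real \<rho> * s) * q ^ k" for k
  proof -
    have "(1 - (\<mu> + of_real (real k / \<rho>))) * (of_real \<rho> * s) = (1 - \<mu>) * (of_real \<rho> * s) + of_nat k * (- s)"
      using \<open>\<rho> \<noteq> 0\<close> by (simp add: field_simps)
    then have "exp ((1 - (\<mu> + of_real (real k / \<rho>))) * (of_real \<rho> * s)) = exp ((1 - \<mu>) * (of_real \<rho> * s)) * exp (- s) ^ k"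
      by (simp only: exp_add exp_of_nat_mult)
    then show ?thesis
      by (simp only: hankel_def q_def power_mult_distrib mult_ac)
  qed
  then have "(\<Sum>k<N. z ^ k * hankel (\<mu> + of_real (real k / \<rho>)) (of_real \<rho> * s))
      = hankel \<mu> (of_real \<rho> * s) * ((1 - q ^ N) / (1 - q))"
    using \<open>q \<noteq> 1\<close> by (simp add: sum_gp_strict flip: sum_distrib_left)
  then show ?thesis
    using \<open>q \<noteq> 1\<close> unfolding ml_form_def frac q_def[symmetric] by (simp add: field_simps)
qed

text \<open>
  On the three-sided contour made of the lines \<open>Im s = \<plusminus> \<pi> / \<rho>\<close> to the right of \<open>R\<close> and the segment that joins
  them at \<open>Re s = R\<close>, the ratio \<open>z exp (- s)\<close> is at most \<open>1 / 2\<close> in modulus. Hence the jump of the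
  \<open>N\<close>-th remainder is at most a constant times \<open>2\<^sup>-\<^sup>N\<close>, uniformly in \<open>x\<close>, and the bound survives the limit
  \<open>x \<longrightarrow> \<infinity>\<close>. The scaling \<open>u = \<rho> s\<close> maps the two lines to those of Hankel's formula.
\<close>
lemma mittag_leffler_sums_jump:
  assumes "\<rho> > 0" "z \<noteq> 0"
    and \<Phi>: "\<And>s. s \<in> cut_plane z \<Longrightarrow> (\<Phi> has_field_derivative ml_form \<rho> \<mu> z s) (at s)"
    and Lp: "((\<lambda>x. \<Phi> (Complex x (pi / \<rho>))) \<longlongrightarrow> Lp) at_top"
    and Lm: "((\<lambda>x. \<Phi> (Complex x (- pi / \<rho>))) \<longlongrightarrow> Lm) at_top"
  shows "(\<lambda>k. z ^ k * rGamma (\<mu> + of_real (real k / \<rho>))) sums (of_real \<rho> / (2 * of_real pi * \<i>) * (Lp - Lm))"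
proof -
  define Y where "Y = pi / \<rho>"
  have Y: "Y > 0" "\<rho> * Y = pi" "- pi / \<rho> = - Y" using \<open>\<rho> > 0\<close> by (auto simp: Y_def)
  have "\<exists>X. \<forall>x\<ge>X. 2 * cmod z \<le> exp x \<and> cmod (ml_form \<rho> \<mu> z (Complex x y)) \<le> 2 * exp (- \<rho> * x)"
    if "y = Y \<or> y = - Y" for y
    using ml_form_decay_at_top[of \<rho> z y y \<mu>] that assms(1,2) Y(2) by auto
  from this[of Y] this[of "- Y"] obtain Xp Xm where
    Xp: "\<And>x. x \<ge> Xp \<Longrightarrow> 2 * cmod z \<le> exp x \<and> cmod (ml_form \<rho> \<mu> z (Complex x Y)) \<le> 2 * exp (- \<rho> * x)" and
    Xm: "\<And>x. x \<ge> Xm \<Longrightarrow> 2 * cmod z \<le> exp x \<and> cmod (ml_form \<rho> \<mu> z (Complex x (- Y))) \<le> 2 * exp (- \<rho> * x)"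
    by blast
  define R where "R = max Xp Xm"
  have R: "2 * cmod z \<le> exp x" if "x \<ge> R" for x
    using Xp[of x] that by (auto simp: R_def)
  have "\<forall>k. \<exists>P. \<forall>u. (P has_field_derivative hankel (\<mu> + of_real (real k / \<rho>)) u) (at u)"
    using hankel_has_primitive by metis
  then obtain P where P: "\<And>k u. (P k has_field_derivative hankel (\<mu> + of_real (real k / \<rho>)) u) (at u)"
    by metis
  \<comment> \<open>\<open>\<Psi> N\<close> is a primitive of the \<open>N\<close>-th remainder \<open>\<psi> N\<close>, as the geometric summation shows.\<close>
  define \<Psi> where "\<Psi> N s = \<Phi> s - (\<Sum>k<N. z ^ k * (P k (of_real \<rho> * s) / of_real \<rho>))" for N s
  define \<psi> where "\<psi> N s = ml_form \<rho> \<mu> z s * (z * exp (- s)) ^ N" for N s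
  have \<Psi>: "(\<Psi> N has_field_derivative \<psi> N (Complex x y)) (at (Complex x y))" if "x \<ge> R" for N x y
  proof -
    define s where "s = Complex x y"
    have s: "s \<in> cut_plane z" unfolding s_def by (rule right_of_cut[OF assms(2) R[OF that]])
    have "((\<lambda>s. P k (of_real \<rho> * s) / of_real \<rho>) has_field_derivative hankel (\<mu> + of_real (real k / \<rho>)) (of_real \<rho> * s)) (at s)" for k
    proof -
      have "((\<lambda>s. of_real \<rho> * s) has_field_derivative of_real \<rho>) (at s)"
        by (auto intro!: derivative_eq_intros)
      from DERIV_cdivide[OF DERIV_chain2[OF P this], where c="of_real \<rho>"] show ?thesis
        using \<open>\<rho> > 0\<close> by simp
    qed
    then have "(\<Psi> N has_field_derivative ml_form \<rho> \<mu> z s - (\<Sum>k<N. z ^ k * hankel (\<mu> + of_real (real k / \<rho>)) (of_real \<rho> * s))) (at s)"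
      unfolding \<Psi>_def by (intro DERIV_diff \<Phi> s DERIV_sum DERIV_cmult)
    then show ?thesis
      using ml_form_geometric_remainder[of \<rho> s z \<mu> N] \<open>\<rho> > 0\<close> exp_neq_on_cut_plane[OF assms(2) s]
      by (simp add: \<psi>_def s_def)
  qed
  have \<psi>_le: "cmod (\<psi> N (Complex x y)) \<le> cmod (ml_form \<rho> \<mu> z (Complex x y)) * (1 / 2) ^ N" if "x \<ge> R" for N x y
  proof -
    have "cmod (z * exp (- Complex x y)) = cmod z / exp x"
      unfolding norm_mult norm_exp_eq_Re by (simp add: exp_minus divide_inverse)
    also have "\<dots> \<le> 1 / 2" using R[OF that] by (simp add: field_simps)
    finally show ?thesis
      unfolding \<psi>_def norm_mult norm_power by (intro mult_left_mono power_mono) auto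
  qed
  define B where "B = 2 * exp (exp (\<rho> * R) + (1 - Re \<mu>) * (\<rho> * R) + \<bar>Im \<mu>\<bar> * pi)"
  define C where "C = B * (2 * Y) + 2 * (2 / \<rho> * exp (- \<rho> * R))"
  have vertical: "cmod (\<Psi> N (Complex R Y) - \<Psi> N (Complex R (- Y))) \<le> B * (1 / 2) ^ N * (2 * Y)" for N
  proof -
    have "cmod (\<Psi> N (Complex R Y) - \<Psi> N (Complex R (- Y))) \<le> B * (1 / 2) ^ N * (Y - - Y)"
    proof (rule vertical_increment_bound[OF _ \<Psi>])
      fix y assume y: "y \<in> {- Y..Y}"
      have "\<rho> * \<bar>y\<bar> \<le> \<rho> * Y" using y \<open>\<rho> > 0\<close> by (intro mult_left_mono) auto
      then have "\<bar>Im \<mu>\<bar> * \<bar>\<rho> * y\<bar> \<le> \<bar>Im \<mu>\<bar> * pi"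
        using \<open>\<rho> > 0\<close> Y(2) by (intro mult_left_mono) (auto simp: abs_mult)
      then have "cmod (hankel \<mu> (Complex (\<rho> * R) (\<rho> * y))) \<le> exp (exp (\<rho> * R) + (1 - Re \<mu>) * (\<rho> * R) + \<bar>Im \<mu>\<bar> * pi)"
        by (intro order_trans[OF norm_hankel_le]) simp
      then have "cmod (ml_form \<rho> \<mu> z (Complex R y)) \<le> B"
        using norm_ml_form_le_right[OF R[OF order_refl], of \<rho> \<mu> y] by (simp add: B_def)
      then show "cmod (\<psi> N (Complex R y)) \<le> B * (1 / 2) ^ N"
        by (intro order_trans[OF \<psi>_le] mult_right_mono) auto
    qed (use Y in auto)
    then show ?thesis by simp
  qed
  have horizontal: "cmod (\<Psi> N (Complex x y) - \<Psi> N (Complex R y)) \<le> (2 * (1 / 2) ^ N) / \<rho> * exp (- \<rho> * R)"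
    if "x \<ge> R" "y = Y \<or> y = - Y" for N x y
  proof (rule increment_bound_exp[OF \<open>\<rho> > 0\<close>])
    fix t assume "t \<ge> R"
    then show "((\<lambda>x. \<Psi> N (Complex x y)) has_vector_derivative \<psi> N (Complex t y)) (at t)"
      by (intro has_vector_derivative_Complex_line \<Psi>)
    have "cmod (ml_form \<rho> \<mu> z (Complex t y)) \<le> 2 * exp (- \<rho> * t)"
      using Xp[of t] Xm[of t] that(2) \<open>t \<ge> R\<close> by (auto simp: R_def)
    then have *: "cmod (ml_form \<rho> \<mu> z (Complex t y)) * (1 / 2) ^ N \<le> (2 * exp (- \<rho> * t)) * (1 / 2) ^ N"
      by (intro mult_right_mono) auto
    show "cmod (\<psi> N (Complex t y)) \<le> 2 * (1 / 2) ^ N * exp (- \<rho> * t)"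
      using order_trans[OF \<psi>_le[OF \<open>t \<ge> R\<close>, of N y] *] by (simp only: mult_ac)
  qed (use that in auto)
  have jump_le: "cmod (\<Psi> N (Complex x Y) - \<Psi> N (Complex x (- Y))) \<le> C * (1 / 2) ^ N" if "x \<ge> R" for N x
  proof -
    have "\<Psi> N (Complex x Y) - \<Psi> N (Complex x (- Y)) =
        (\<Psi> N (Complex x Y) - \<Psi> N (Complex R Y)) - (\<Psi> N (Complex x (- Y)) - \<Psi> N (Complex R (- Y)))
        + (\<Psi> N (Complex R Y) - \<Psi> N (Complex R (- Y)))" by simp
    also have "cmod \<dots> \<le> cmod (\<Psi> N (Complex x Y) - \<Psi> N (Complex R Y)) + cmod (\<Psi> N (Complex x (- Y)) - \<Psi> N (Complex R (- Y)))
        + cmod (\<Psi> N (Complex R Y) - \<Psi> N (Complex R (- Y)))"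
      by (rule order_trans[OF norm_triangle_ineq]) (intro add_right_mono norm_triangle_ineq4)
    also have "\<dots> \<le> (2 * (1 / 2) ^ N) / \<rho> * exp (- \<rho> * R) + (2 * (1 / 2) ^ N) / \<rho> * exp (- \<rho> * R) + B * (1 / 2) ^ N * (2 * Y)"
      using that by (intro add_mono horizontal vertical) auto
    also have "\<dots> = C * (1 / 2) ^ N" by (simp add: C_def algebra_simps)
    finally show ?thesis .
  qed
  define S where "S N = (\<Sum>k<N. z ^ k * rGamma (\<mu> + of_real (real k / \<rho>)))" for N
  have remainder: "cmod ((Lp - Lm) - 2 * pi * \<i> / \<rho> * S N) \<le> C * (1 / 2) ^ N" for N
  proof (rule tendsto_upperbound)
    have jump_P: "((\<lambda>x. P k (of_real \<rho> * Complex x Y) / of_real \<rho> - P k (of_real \<rho> * Complex x (- Y)) / of_real \<rho>)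
       \<longlongrightarrow> 2 * pi * \<i> / \<rho> * rGamma (\<mu> + of_real (real k / \<rho>))) at_top" for k
    proof -
      have "filterlim (\<lambda>x. \<rho> * x) at_top at_top"
        using \<open>\<rho> > 0\<close> by real_asymp
      note lim = filterlim_compose[OF hankel_jump_tendsto_rGamma[OF P] this]
      have "((\<lambda>x. (P k (Complex (\<rho> * x) pi) - P k (Complex (\<rho> * x) (- pi))) / of_real \<rho>)
        \<longlongrightarrow> 2 * pi * \<i> * rGamma (\<mu> + of_real (real k / \<rho>)) / of_real \<rho>) at_top"
        using \<open>\<rho> > 0\<close> by (intro tendsto_divide lim tendsto_const) auto
      then show ?thesis using \<open>\<rho> > 0\<close> Y(2) by (simp add: of_real_mult_Complex diff_divide_distrib)
    qed
    have "((\<lambda>x. (\<Phi> (Complex x Y) - \<Phi> (Complex x (- Y))) - (\<Sum>k<N. z ^ k *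
        (P k (of_real \<rho> * Complex x Y) / of_real \<rho> - P k (of_real \<rho> * Complex x (- Y)) / of_real \<rho>)))
      \<longlongrightarrow> (Lp - Lm) - (\<Sum>k<N. z ^ k * (2 * pi * \<i> / \<rho> * rGamma (\<mu> + of_real (real k / \<rho>))))) at_top"
      using Lp Lm unfolding Y(3) Y_def[symmetric] by (intro tendsto_intros jump_P)
    moreover have "(\<Sum>k<N. z ^ k * (2 * pi * \<i> / \<rho> * rGamma (\<mu> + of_real (real k / \<rho>)))) = 2 * pi * \<i> / \<rho> * S N"
      by (simp add: S_def sum_distrib_left mult_ac)
    moreover have "(\<Phi> (Complex x Y) - \<Phi> (Complex x (- Y))) - (\<Sum>k<N. z ^ k *
        (P k (of_real \<rho> * Complex x Y) / of_real \<rho> - P k (of_real \<rho> * Complex x (- Y)) / of_real \<rho>))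
       = \<Psi> N (Complex x Y) - \<Psi> N (Complex x (- Y))" for x
      by (simp add: \<Psi>_def right_diff_distrib sum_subtractf)
    ultimately show "((\<lambda>x. cmod (\<Psi> N (Complex x Y) - \<Psi> N (Complex x (- Y)))) \<longlongrightarrow> cmod ((Lp - Lm) - 2 * pi * \<i> / \<rho> * S N)) at_top"
      by (intro tendsto_norm) simp
    show "\<forall>\<^sub>F x in at_top. cmod (\<Psi> N (Complex x Y) - \<Psi> N (Complex x (- Y))) \<le> C * (1 / 2) ^ N"
      unfolding eventually_at_top_linorder using jump_le by (intro exI[of _ R] allI impI)
  qed (rule trivial_limit_at_top_linorder)
  have "(\<lambda>N. C * (1 / 2) ^ N) \<longlonglongrightarrow> 0"
    by real_asymp
  then have "(\<lambda>N. (Lp - Lm) - 2 * pi * \<i> / \<rho> * S N) \<longlonglongrightarrow> 0"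
    by (rule Lim_null_comparison[rotated]) (intro always_eventually allI remainder)
  from tendsto_diff[OF tendsto_const this, of "Lp - Lm"] have "(\<lambda>N. 2 * pi * \<i> / \<rho> * S N) \<longlonglongrightarrow> Lp - Lm"
    by simp
  from tendsto_mult[OF tendsto_const this, of "of_real \<rho> / (2 * of_real pi * \<i>)"]
  have "S \<longlonglongrightarrow> of_real \<rho> / (2 * of_real pi * \<i>) * (Lp - Lm)"
    using \<open>\<rho> > 0\<close> by simp
  then show ?thesis by (simp add: sums_def S_def[abs_def])
qed

section \<open>The kernels as derivatives of the primitive\<close>
lemma zpow_eq_exp: "zpow z r a = exp (a * Complex (ln (cmod z * r)) (Arg2pi z))"
  by (simp add: zpow_def Complex_eq)

text \<open>
  The logarithm of \<open>z r e\<^bsup>\<i> (\<phi> - \<pi>)\<^esup>\<close> on the sheet that the kernels use; \<open>\<phi> = \<plusminus> \<pi>\<close> gives the two rays that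
  meet a pole at \<open>r = 1\<close>.
\<close>
definition ray_point :: "complex \<Rightarrow> real \<Rightarrow> real \<Rightarrow> complex" where
  "ray_point z \<phi> r = Complex (ln (cmod z * r)) (Arg2pi z - pi + \<phi>)"

text \<open>
  The kernels split the double exponential and the power into a real-angle part and an \<open>\<eta>\<close> or \<open>\<chi>'\<close> part;
  Euler's formula reassembles them at the point \<open>s + \<i> \<alpha>\<close>.
\<close>
lemma exp_combine_polar:
  fixes \<rho> \<alpha> :: real and \<mu> :: complex
  assumes W: "W = exp (of_real \<rho> * s)" and V: "V = exp (of_real \<rho> * (1 - \<mu>) * s)"
  shows "exp (W * of_real (cos (\<rho> * \<alpha>))) * V * exp (\<i> * (W * of_real (sin (\<rho> * \<alpha>)) + of_real \<rho> * (1 - \<mu>) * of_real \<alpha>))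
       = hankel \<mu> (of_real \<rho> * (s + \<i> * of_real \<alpha>))"
proof -
  have "W * exp (\<i> * of_real (\<rho> * \<alpha>)) = W * of_real (cos (\<rho> * \<alpha>)) + \<i> * (W * of_real (sin (\<rho> * \<alpha>)))"
    unfolding exp_Euler by (simp add: algebra_simps flip: cos_of_real sin_of_real)
  moreover have "exp (of_real \<rho> * (s + \<i> * of_real \<alpha>)) = W * exp (\<i> * of_real (\<rho> * \<alpha>))"
    by (simp add: W algebra_simps flip: exp_add)
  ultimately have "exp (exp (of_real \<rho> * (s + \<i> * of_real \<alpha>))) = exp (W * of_real (cos (\<rho> * \<alpha>))) * exp (\<i> * (W * of_real (sin (\<rho> * \<alpha>))))"
    by (simp add: exp_add)
  moreover have "exp ((1 - \<mu>) * (of_real \<rho> * (s + \<i> * of_real \<alpha>))) = V * exp (\<i> * (of_real \<rho> * (1 - \<mu>) * of_real \<alpha>))"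
    by (simp add: V algebra_simps flip: exp_add)
  ultimately show ?thesis
    by (simp add: hankel_def distrib_left exp_add)
qed

text \<open>
  With \<open>c = e\<^bsup>\<i> \<phi>\<^esup>\<close> the denominator of the kernel factors as \<open>(r + c) (r + cnj c)\<close>, so the rational factor
  collapses to \<open>c / (r c + 1)\<close>. This is \<open>exp s / (exp s - z)\<close> up to the factor \<open>r\<close> that comes from \<open>ds = dr / r\<close>.
\<close>
lemma ml_K'_eq_ml_form:
  assumes "z \<noteq> 0" "r > 0" "ray_point z \<phi> r \<in> cut_plane z"
  shows "ml_K' \<rho> \<mu> r \<phi> z = of_real \<rho> / (2 * of_real pi * \<i>) * (ml_form \<rho> \<mu> z (ray_point z \<phi> r) / of_real r)"
proof -
  define c where "c = exp (\<i> * of_real \<phi>)"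
  define s0 where "s0 = Complex (ln (cmod z * r)) (Arg2pi z) - \<i> * of_real pi"
  define W where "W = zpow z r (of_real \<rho>) * exp (- \<i> * of_real (\<rho> * pi))"
  define V where "V = zpow z r (of_real \<rho> * (1 - \<mu>)) * exp (\<i> * (- of_real (pi * \<rho>) * (1 - \<mu>)))"
  have s: "ray_point z \<phi> r = s0 + \<i> * of_real \<phi>"
    by (simp add: ray_point_def s0_def complex_eq_iff)
  have "W = exp (of_real \<rho> * s0)"
    by (simp add: W_def s0_def zpow_eq_exp algebra_simps flip: exp_add)
  moreover have "V = exp (of_real \<rho> * (1 - \<mu>) * s0)"
    by (simp add: V_def s0_def zpow_eq_exp algebra_simps flip: exp_add)
  ultimately have hankel: "exp (W * of_real (cos (\<rho> * \<phi>))) * V * exp (\<i> * (W * of_real (sin (\<rho> * \<phi>)) + of_real \<rho> * (1 - \<mu>) * of_real \<phi>))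
      = hankel \<mu> (of_real \<rho> * ray_point z \<phi> r)"
    unfolding s by (rule exp_combine_polar)
  have eta: "exp (\<i> * (ml_eta \<rho> \<mu> r \<phi> z - of_real (pi * \<rho>) * (1 - \<mu>)))
     = exp (\<i> * (W * of_real (sin (\<rho> * \<phi>)) + of_real \<rho> * (1 - \<mu>) * of_real \<phi>)) * exp (\<i> * (- of_real (pi * \<rho>) * (1 - \<mu>)))"
    by (simp add: ml_eta_def W_def algebra_simps flip: exp_add)
  have "exp (ray_point z \<phi> r) = exp (Complex (ln (cmod z)) (Arg2pi z)) * exp (of_real (ln r)) * exp (- (\<i> * of_real pi)) * c"
    using assms(1,2) by (simp add: ray_point_def c_def Complex_eq ln_mult algebra_simps flip: exp_add)
  then have exp_s: "exp (ray_point z \<phi> r) = - z * of_real r * c"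
    using assms(1,2) exp_ln_norm_Arg2pi[OF assms(1)] by (simp add: exp_minus exp_of_real)
  have ne: "of_real r * c + 1 \<noteq> 0"
  proof
    assume "of_real r * c + 1 = 0"
    then have "of_real r * c = - 1" by (simp only: eq_neg_iff_add_eq_0)
    then have "exp (ray_point z \<phi> r) = z" by (simp add: exp_s mult.assoc)
    then show False using exp_neq_on_cut_plane[OF assms(1,3)] by simp
  qed
  have c_cnj: "c * cnj c = 1" by (simp add: c_def exp_cnj flip: exp_add)
  have ne': "of_real r + c \<noteq> 0"
  proof
    assume "of_real r + c = 0"
    then have "cnj c * (of_real r + c) = 0" by simp
    then have "cnj (of_real r * c + 1) = 0" using c_cnj by (simp add: algebra_simps)
    then show False using ne by (simp only: complex_cnj_zero_iff)
  qed
  have c_plus_cnj: "c + cnj c = of_real (2 * cos \<phi>)"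
    by (simp add: complex_eq_iff c_def Re_exp Im_exp)
  have den: "complex_of_real (r\<^sup>2 + 2 * r * cos \<phi> + 1) = (of_real r + c) * (of_real r + cnj c)"
  proof -
    have "complex_of_real (r\<^sup>2 + 2 * r * cos \<phi> + 1) = of_real r * of_real r + of_real r * of_real (2 * cos \<phi>) + 1"
      by (simp add: power2_eq_square mult_ac)
    also have "\<dots> = of_real r * of_real r + of_real r * (c + cnj c) + c * cnj c"
      by (simp only: c_cnj c_plus_cnj)
    also have "\<dots> = (of_real r + c) * (of_real r + cnj c)"
      by (simp only: distrib_left distrib_right add_ac mult_ac)
    finally show ?thesis .
  qed
  have "(of_real r + c) / of_real (r\<^sup>2 + 2 * r * cos \<phi> + 1) = 1 / (of_real r + cnj c)"
    using ne' unfolding den by simp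
  also have "of_real r + cnj c = (of_real r * c + 1) * cnj c"
    using c_cnj by (simp add: algebra_simps)
  also have "1 / ((of_real r * c + 1) * cnj c) = c / (of_real r * c + 1)"
  proof -
    have "cnj c = inverse c" using c_cnj by (metis inverse_unique mult.commute)
    then show ?thesis by (simp add: field_simps)
  qed
  finally have frac: "(of_real r + c) / of_real (r\<^sup>2 + 2 * r * cos \<phi> + 1) = c / (of_real r * c + 1)" .
  have "exp (ray_point z \<phi> r) / (exp (ray_point z \<phi> r) - z) = (- z * (of_real r * c)) / (- z * (of_real r * c + 1))"
    unfolding exp_s by (simp add: algebra_simps)
  also have "\<dots> = of_real r * c / (of_real r * c + 1)"
    using assms(1) by (subst mult_divide_mult_cancel_left) auto
  finally have form: "ml_form \<rho> \<mu> z (ray_point z \<phi> r) / of_real r = hankel \<mu> (of_real \<rho> * ray_point z \<phi> r) * (c / (of_real r * c + 1))"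
    using assms(2) by (simp add: ml_form_def)
  have "ml_K' \<rho> \<mu> r \<phi> z = of_real \<rho> / (2 * of_real pi * \<i>) *
     ((exp (W * of_real (cos (\<rho> * \<phi>))) * V * exp (\<i> * (W * of_real (sin (\<rho> * \<phi>)) + of_real \<rho> * (1 - \<mu>) * of_real \<phi>)))
      * ((of_real r + c) / of_real (r\<^sup>2 + 2 * r * cos \<phi> + 1)))"
    unfolding ml_K'_def eta by (simp add: W_def V_def c_def mult_ac)
  also have "\<dots> = of_real \<rho> / (2 * of_real pi * \<i>) * (ml_form \<rho> \<mu> z (ray_point z \<phi> r) / of_real r)"
    unfolding hankel frac form ..
  finally show ?thesis .
qed

lemma ml_K'_primitive:
  assumes "z \<noteq> 0" "r > 0" "ray_point z \<phi> r \<in> cut_plane z"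
    and \<Phi>: "\<And>s. s \<in> cut_plane z \<Longrightarrow> (\<Phi> has_field_derivative ml_form \<rho> \<mu> z s) (at s)"
  shows "((\<lambda>r. of_real \<rho> / (2 * of_real pi * \<i>) * \<Phi> (ray_point z \<phi> r)) has_vector_derivative ml_K' \<rho> \<mu> r \<phi> z) (at r)"
proof -
  define x where "x = (\<lambda>r. ln (cmod z * r))"
  have "(x has_real_derivative 1 / r) (at r)"
    unfolding x_def using assms(1,2) by (auto intro!: derivative_eq_intros)
  then have x: "(x has_vector_derivative 1 / r) (at r)"
    by (simp add: has_real_derivative_iff_has_vector_derivative)
  have "((\<lambda>x. \<Phi> (Complex x (Arg2pi z - pi + \<phi>))) has_vector_derivative ml_form \<rho> \<mu> z (ray_point z \<phi> r)) (at (x r))"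
    using \<Phi>[OF assms(3)] unfolding ray_point_def x_def by (rule has_vector_derivative_Complex_line)
  from vector_diff_chain_at[OF x this]
  have "((\<lambda>r. \<Phi> (ray_point z \<phi> r)) has_vector_derivative ml_form \<rho> \<mu> z (ray_point z \<phi> r) / of_real r) (at r)"
    by (simp add: o_def x_def ray_point_def scaleR_conv_of_real)
  from has_vector_derivative_mult_right[OF this, of "of_real \<rho> / (2 * of_real pi * \<i>)"]
  show ?thesis unfolding ml_K'_eq_ml_form[OF assms(1,2,3)] .
qed

lemma ray_tendsto_at_top:
  fixes \<Phi> :: "complex \<Rightarrow> complex"
  assumes "z \<noteq> 0" "((\<lambda>x. \<Phi> (Complex x (Arg2pi z - pi + \<phi>))) \<longlongrightarrow> L) at_top"
  shows "((\<lambda>r. c * \<Phi> (ray_point z \<phi> r)) \<longlongrightarrow> c * L) at_top"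
proof -
  have "cmod z > 0" using assms(1) by simp
  then have "filterlim (\<lambda>r. ln (cmod z * r)) at_top at_top" by real_asymp
  note lim = filterlim_compose[OF assms(2) this]
  show ?thesis
    unfolding ray_point_def by (rule tendsto_mult[OF tendsto_const lim])
qed

lemma ray_tendsto_at_right_0:
  fixes \<Phi> :: "complex \<Rightarrow> complex"
  assumes "z \<noteq> 0" "((\<lambda>x. \<Phi> (Complex x (Arg2pi z - pi + \<phi>))) \<longlongrightarrow> L) at_bot"
  shows "((\<lambda>r. c * \<Phi> (ray_point z \<phi> r)) \<longlongrightarrow> c * L) (at_right 0)"
proof -
  have "cmod z > 0" using assms(1) by simp
  then have "filterlim (\<lambda>r. ln (cmod z * r)) at_bot (at_right 0)" by real_asymp
  note lim = filterlim_compose[OF assms(2) this]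
  show ?thesis
    unfolding ray_point_def by (rule tendsto_mult[OF tendsto_const lim])
qed

lemma ray_point_in_cut_plane_angle:
  "- pi < \<phi> \<Longrightarrow> \<phi> < pi \<Longrightarrow> ray_point z \<phi> r \<in> cut_plane z"
  by (simp add: ray_point_def cut_plane_def)

lemma ray_point_in_cut_plane_radius:
  assumes "z \<noteq> 0" "r > 0" "r \<noteq> 1"
  shows "ray_point z \<phi> r \<in> cut_plane z"
proof -
  have "ln (cmod z * r) \<noteq> ln (cmod z)" using assms by simp
  then show ?thesis by (simp add: ray_point_def cut_plane_def)
qed

text \<open>
  The logarithm of \<open>z (1 + \<tau> e\<^bsup>\<i> \<psi>\<^esup>)\<close> on the sheet shifted by \<open>k \<pi>\<close>, for even \<open>k\<close>: a point of the circle of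
  radius \<open>\<tau> cmod z\<close> about \<open>z\<close>. For \<open>\<tau> < 1\<close> this circle does not surround the origin, so the principal
  branch of \<open>Ln\<close> is the right one along the whole arc.
\<close>
definition arc_point :: "complex \<Rightarrow> real \<Rightarrow> int \<Rightarrow> real \<Rightarrow> complex" where
  "arc_point z \<tau> k \<psi> = Complex (ln (cmod z)) (Arg2pi z + of_int k * pi) + Ln (1 + of_real \<tau> * exp (\<i> * of_real \<psi>))"

lemma arc_polar:
  fixes \<tau> \<psi> :: real
  assumes "0 < \<tau>" "\<tau> < 1"
  defines "w \<equiv> 1 + of_real \<tau> * exp (\<i> * of_real \<psi>)"
  shows "Re w > 0" "cmod w = arc_radius \<tau> \<psi>" "Im (Ln w) = arc_angle \<tau> \<psi> 0" "\<bar>Im (Ln w)\<bar> < pi / 2"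
proof -
  have Re: "Re w = \<tau> * cos \<psi> + 1" and Im: "Im w = \<tau> * sin \<psi>"
    by (simp_all add: w_def Re_exp Im_exp)
  have "\<tau> * (- cos \<psi>) \<le> \<tau> * 1"
    using assms(1) by (intro mult_left_mono) (use cos_ge_minus_one[of \<psi>] in linarith)+
  then show pos: "Re w > 0" unfolding Re using assms(2) by simp
  have "(\<tau> * cos \<psi> + 1)\<^sup>2 + (\<tau> * sin \<psi>)\<^sup>2 = \<tau>\<^sup>2 * ((sin \<psi>)\<^sup>2 + (cos \<psi>)\<^sup>2) + 2 * \<tau> * cos \<psi> + 1"
    by algebra
  then show "cmod w = arc_radius \<tau> \<psi>"
    unfolding cmod_def Re Im arc_radius_def by simp
  have "w \<noteq> 0" using pos by auto
  then show "Im (Ln w) = arc_angle \<tau> \<psi> 0"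
    using arg_conv_arctan[OF pos] Arg_eq_Im_Ln[of w] by (simp add: arc_angle_def Re Im)
  show "\<bar>Im (Ln w)\<bar> < pi / 2" using Re_Ln_pos_lt_imp[OF pos] .
qed

text \<open>
  Since \<open>r e\<^bsup>\<i> \<phi>\<^esup> - 1 = \<tau> e\<^bsup>\<i> \<psi>\<^esup>\<close>, the rational factor of \<open>P'\<close> is \<open>1 / (\<tau> e\<^bsup>\<i> \<psi>\<^esup>)\<close>, which cancels the factor
  \<open>\<tau> e\<^bsup>\<i> \<psi>\<^esup>\<close> in front. The factor \<open>\<i> e / (1 + e)\<close> on the right is the derivative of the arc.
\<close>
lemma ml_P'_eq_ml_form:
  fixes \<tau> \<psi> :: real
  assumes "z \<noteq> 0" "0 < \<tau>" "\<tau> < 1" "even k"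
  defines "e \<equiv> of_real \<tau> * exp (\<i> * of_real \<psi>)"
  shows "ml_P' \<rho> \<mu> \<tau> \<psi> k z = of_real \<rho> / (2 * of_real pi * \<i>) * (\<i> * e / (1 + e) * ml_form \<rho> \<mu> z (arc_point z \<tau> k \<psi>))"
proof -
  define r where "r = arc_radius \<tau> \<psi>"
  define \<alpha> where "\<alpha> = arc_angle \<tau> \<psi> k"
  define s0 where "s0 = Complex (ln (cmod z * r)) (Arg2pi z)"
  note polar = arc_polar[OF assms(2,3), of \<psi>, folded e_def r_def]
  have "1 + e \<noteq> 0"
  proof
    assume "1 + e = 0"
    with polar(1) show False by (simp only: zero_complex.sel)
  qed
  then have "r > 0" unfolding polar(2)[symmetric] by simp
  have \<alpha>: "\<alpha> = Im (Ln (1 + e)) + of_int k * pi"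
    using polar(3) by (simp add: \<alpha>_def arc_angle_def)
  have s: "arc_point z \<tau> k \<psi> = s0 + \<i> * of_real \<alpha>"
    using \<open>1 + e \<noteq> 0\<close> \<open>r > 0\<close> assms(1) polar(2)
    by (simp add: arc_point_def s0_def complex_eq_iff \<alpha> ln_mult flip: e_def)
  obtain m where k: "k = 2 * m" using \<open>even k\<close> by blast
  have "exp (Complex 0 (of_int k * pi)) = 1"
    unfolding exp_eq_1 by (simp add: k)
  moreover have "Complex (ln (cmod z)) (Arg2pi z + of_int k * pi) = Complex (ln (cmod z)) (Arg2pi z) + Complex 0 (of_int k * pi)"
    by (simp add: complex_eq_iff)
  ultimately have exp_s: "exp (arc_point z \<tau> k \<psi>) = z * (1 + e)"
    unfolding arc_point_def e_def[symmetric]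
    using exp_ln_norm_Arg2pi[OF assms(1)] \<open>1 + e \<noteq> 0\<close> by (simp only: exp_add exp_Ln mult_1_right not_False_eq_True)
  have "e \<noteq> 0" using assms(2) by (simp add: e_def)
  have rw: "of_real r * exp (\<i> * of_real \<alpha>) = 1 + e"
  proof -
    have "of_real r * exp (\<i> * of_real \<alpha>) = exp (Complex (ln r) \<alpha>)"
      using \<open>r > 0\<close> by (simp add: Complex_eq exp_add exp_of_real)
    also have "Complex (ln r) \<alpha> = Ln (1 + e) + Complex 0 (of_int k * pi)"
      using polar(2) \<open>1 + e \<noteq> 0\<close> by (simp add: complex_eq_iff \<alpha>)
    finally show ?thesis
      using \<open>exp (Complex 0 (of_int k * pi)) = 1\<close> \<open>1 + e \<noteq> 0\<close> by (simp add: exp_add)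
  qed
  have "cnj (of_real r * exp (\<i> * of_real \<alpha>) - 1) = of_real r * exp (- \<i> * of_real \<alpha>) - 1"
    by (simp add: exp_cnj)
  then have cnj: "of_real r * exp (- \<i> * of_real \<alpha>) - 1 = cnj e" by (simp add: rw)
  have den: "complex_of_real (r\<^sup>2 - 2 * r * cos \<alpha> + 1) = e * cnj e"
  proof -
    have "e = of_real r * exp (\<i> * of_real \<alpha>) - 1" using rw by simp
    then have "Re e = r * cos \<alpha> - 1" "Im e = r * sin \<alpha>" by (simp_all add: Re_exp Im_exp)
    then have "(Re e)\<^sup>2 + (Im e)\<^sup>2 = (r * cos \<alpha> - 1)\<^sup>2 + (r * sin \<alpha>)\<^sup>2" by (simp only:)
    also have "\<dots> = r\<^sup>2 * ((sin \<alpha>)\<^sup>2 + (cos \<alpha>)\<^sup>2) - 2 * r * cos \<alpha> + 1"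
      by algebra
    finally show ?thesis by (simp add: complex_mult_cnj)
  qed
  have \<tau>: "of_real \<tau> * (exp (\<i> * of_real \<psi>) * (cnj e / (e * cnj e))) = 1"
    using \<open>e \<noteq> 0\<close> by (simp add: e_def)
  have "exp (arc_point z \<tau> k \<psi>) / (exp (arc_point z \<tau> k \<psi>) - z) = (z * (1 + e)) / (z * e)"
    unfolding exp_s by (simp add: algebra_simps)
  then have form: "\<i> * e / (1 + e) * ml_form \<rho> \<mu> z (arc_point z \<tau> k \<psi>) = \<i> * hankel \<mu> (of_real \<rho> * arc_point z \<tau> k \<psi>)"
    using assms(1) \<open>e \<noteq> 0\<close> \<open>1 + e \<noteq> 0\<close> by (simp add: ml_form_def)
  have hankel: "exp (zpow z r (of_real \<rho>) * of_real (cos (\<rho> * \<alpha>))) * zpow z r (of_real \<rho> * (1 - \<mu>)) * exp (\<i> * ml_chi' \<rho> \<mu> \<tau> \<psi> k z)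
     = hankel \<mu> (of_real \<rho> * arc_point z \<tau> k \<psi>)"
    unfolding s ml_chi'_def r_def[symmetric] \<alpha>_def[symmetric]
    by (rule exp_combine_polar) (simp_all add: zpow_eq_exp s0_def)
  have assoc: "of_real (\<rho> * \<tau> / (2 * pi)) * (A / d) * B * (C * F) * n
      = of_real \<rho> / (2 * of_real pi) * (A * B * C) * (of_real \<tau> * (F * (n / d)))" for A B C F d n :: complex
    by (simp add: mult_ac)
  have split: "exp (\<i> * (ml_chi' \<rho> \<mu> \<tau> \<psi> k z + of_real \<psi>)) = exp (\<i> * ml_chi' \<rho> \<mu> \<tau> \<psi> k z) * exp (\<i> * of_real \<psi>)"
    by (simp add: distrib_left exp_add)
  have "ml_P' \<rho> \<mu> \<tau> \<psi> k z = of_real \<rho> / (2 * of_real pi)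
     * (exp (zpow z r (of_real \<rho>) * of_real (cos (\<rho> * \<alpha>))) * zpow z r (of_real \<rho> * (1 - \<mu>)) * exp (\<i> * ml_chi' \<rho> \<mu> \<tau> \<psi> k z))
     * (of_real \<tau> * (exp (\<i> * of_real \<psi>) * (cnj e / (e * cnj e))))"
    unfolding ml_P'_def r_def[symmetric] \<alpha>_def[symmetric] den cnj split by (rule assoc)
  then show ?thesis
    unfolding hankel \<tau> form by simp
qed

lemma ml_P'_primitive:
  assumes "z \<noteq> 0" "0 < \<tau>" "\<tau> < 1" "even k" "arc_point z \<tau> k \<psi> \<in> cut_plane z"
    and \<Phi>: "\<And>s. s \<in> cut_plane z \<Longrightarrow> (\<Phi> has_field_derivative ml_form \<rho> \<mu> z s) (at s)"
  shows "((\<lambda>\<psi>. of_real \<rho> / (2 * of_real pi * \<i>) * \<Phi> (arc_point z \<tau> k \<psi>)) has_vector_derivative ml_P' \<rho> \<mu> \<tau> \<psi> k z) (at \<psi>)"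
proof -
  define e where "e \<psi> = of_real \<tau> * exp (\<i> * of_real \<psi>)" for \<psi> :: real
  have "((\<lambda>\<psi>. \<i> * complex_of_real \<psi>) has_vector_derivative \<i>) (at \<psi>)"
    by (auto intro!: derivative_eq_intros)
  from has_vector_derivative_mult_right[OF field_vector_diff_chain_at[OF this DERIV_exp], of "of_real \<tau>"]
  have "(e has_vector_derivative \<i> * e \<psi>) (at \<psi>)"
    by (simp add: e_def[abs_def] o_def mult_ac)
  then have e: "((\<lambda>\<psi>. 1 + e \<psi>) has_vector_derivative \<i> * e \<psi>) (at \<psi>)"
    by (auto intro!: derivative_eq_intros)
  have "1 + e \<psi> \<notin> \<real>\<^sub>\<le>\<^sub>0"
    using arc_polar(1)[OF assms(2,3), of \<psi>] by (auto simp: e_def complex_nonpos_Reals_iff)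
  then have "((\<lambda>w. Complex (ln (cmod z)) (Arg2pi z + of_int k * pi) + Ln w) has_field_derivative inverse (1 + e \<psi>)) (at (1 + e \<psi>))"
    by (auto intro!: derivative_eq_intros)
  from field_vector_diff_chain_at[OF e this]
  have arc: "(arc_point z \<tau> k has_vector_derivative \<i> * e \<psi> / (1 + e \<psi>)) (at \<psi>)"
    by (simp add: o_def arc_point_def[abs_def] e_def divide_inverse)
  from has_vector_derivative_mult_right[OF field_vector_diff_chain_at[OF arc \<Phi>[OF assms(5)]], of "of_real \<rho> / (2 * of_real pi * \<i>)"]
  show ?thesis
    unfolding ml_P'_eq_ml_form[OF assms(1-4)] by (simp add: o_def e_def)
qed

lemma ml_P'_has_integral:
  assumes "z \<noteq> 0" "0 < \<tau>" "\<tau> < 1" "even k" "a \<le> b"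
    and "\<And>\<psi>. \<psi> \<in> {a..b} \<Longrightarrow> arc_point z \<tau> k \<psi> \<in> cut_plane z"
    and \<Phi>: "\<And>s. s \<in> cut_plane z \<Longrightarrow> (\<Phi> has_field_derivative ml_form \<rho> \<mu> z s) (at s)"
  shows "((\<lambda>\<psi>. ml_P' \<rho> \<mu> \<tau> \<psi> k z) has_integral
     (of_real \<rho> / (2 * of_real pi * \<i>) * \<Phi> (arc_point z \<tau> k b) - of_real \<rho> / (2 * of_real pi * \<i>) * \<Phi> (arc_point z \<tau> k a))) {a..b}"
proof (rule fundamental_theorem_of_calculus[OF assms(5),
      where f="\<lambda>\<psi>. of_real \<rho> / (2 * of_real pi * \<i>) * \<Phi> (arc_point z \<tau> k \<psi>)"])
  fix \<psi> assume "\<psi> \<in> {a..b}"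
  from ml_P'_primitive[OF assms(1-4) assms(6)[OF this] \<Phi>]
  show "((\<lambda>\<psi>. of_real \<rho> / (2 * of_real pi * \<i>) * \<Phi> (arc_point z \<tau> k \<psi>)) has_vector_derivative
      ml_P' \<rho> \<mu> \<tau> \<psi> k z) (at \<psi> within {a..b})"
    by (rule has_vector_derivative_at_within)
qed

lemma arc_point_end:
  assumes "z \<noteq> 0" "0 < \<tau>" "\<tau> < 1" "exp (\<i> * of_real \<psi>) = of_real t" "t = 1 \<or> t = - 1"
  shows "arc_point z \<tau> k \<psi> = ray_point z (pi + of_int k * pi) (1 + t * \<tau>)"
proof -
  have pos: "1 + t * \<tau> > 0" using assms(2,3,5) by auto
  have "1 + of_real \<tau> * exp (\<i> * of_real \<psi>) = complex_of_real (1 + t * \<tau>)"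
    using assms(4) by (simp add: mult.commute)
  then have "Ln (1 + of_real \<tau> * exp (\<i> * of_real \<psi>)) = of_real (ln (1 + t * \<tau>))"
    using Ln_of_real[OF pos] by (simp only:)
  then show ?thesis
    using pos assms(1) by (simp add: arc_point_def ray_point_def complex_eq_iff ln_mult)
qed

text \<open>
  The half circle with \<open>k = 0\<close> passes below the upper pole and the one with \<open>k = -2\<close> passes above the lower
  pole, so both stay off the cuts. Their end points lie beside the poles, where only the distance from
  the line \<open>Re s = ln (cmod z)\<close> matters.
\<close>
lemma arc_point_in_cut_plane:
  assumes "z \<noteq> 0" "0 < \<tau>" "\<tau> < 1"
    and "k = 0 \<and> \<psi> \<in> {- pi..0} \<or> k = - 2 \<and> \<psi> \<in> {- 2 * pi..- pi}"
  shows "arc_point z \<tau> k \<psi> \<in> cut_plane z"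
proof (cases "sin \<psi> = 0")
  case True
  define t where "t = cos \<psi>"
  have t: "t = 1 \<or> t = - 1"
    using True sin_cos_squared_add[of \<psi>] by (auto simp: t_def power2_eq_1_iff)
  have "exp (\<i> * of_real \<psi>) = of_real t"
    using True by (simp add: t_def complex_eq_iff Re_exp Im_exp)
  from arc_point_end[OF assms(1-3) this t] show ?thesis
    using assms(2,3) t by (simp only:) (rule ray_point_in_cut_plane_radius[OF assms(1)]; fastforce)
next
  case False
  define w where "w = 1 + of_real \<tau> * exp (\<i> * of_real \<psi>)"
  note polar = arc_polar[OF assms(2,3), of \<psi>, folded w_def]
  have "w \<noteq> 0" using polar(1) by auto
  have Im_w: "Im w = \<tau> * sin \<psi>" by (simp add: w_def Im_exp)
  have Ln_neg: "Im (Ln w) < 0" if "sin \<psi> < 0"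
  proof -
    have "\<not> 0 \<le> Im w" using that assms(2) unfolding Im_w by (simp add: zero_le_mult_iff)
    then show ?thesis using Im_Ln_pos_le[OF \<open>w \<noteq> 0\<close>] polar(4) pi_gt_zero by linarith
  qed
  have Ln_pos: "Im (Ln w) > 0" if "sin \<psi> > 0"
  proof -
    have "0 < Im w" using that assms(2) unfolding Im_w by (rule mult_pos_pos[rotated])
    then show ?thesis by (rule Im_Ln_pos_lt_imp[THEN conjunct1])
  qed
  have Im: "Im (arc_point z \<tau> k \<psi>) = Arg2pi z + of_int k * pi + Im (Ln w)"
    by (simp add: arc_point_def w_def)
  from assms(4) show ?thesis
  proof
    assume k: "k = 0 \<and> \<psi> \<in> {- pi..0}"
    have "sin (- \<psi>) \<ge> 0" using k by (intro sin_ge_zero) auto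
    then have "Im (Ln w) < 0" using False by (intro Ln_neg) simp
    then show ?thesis using Im polar(4) k by (simp add: cut_plane_def)
  next
    assume k: "k = - 2 \<and> \<psi> \<in> {- 2 * pi..- pi}"
    have "sin (\<psi> + 2 * pi) \<ge> 0" using k by (intro sin_ge_zero) auto
    then have "Im (Ln w) > 0" using False by (intro Ln_pos) simp
    then show ?thesis using Im polar(4) k by (simp add: cut_plane_def)
  qed
qed

text \<open>
  The four-argument kernel is a difference of two ray kernels over a common denominator. A vanishing
  denominator must be excluded, as \<open>d / 0 = 0\<close> would then also annihilate the other term.
\<close>
lemma ml_K4_eq_diff:
  assumes "r\<^sup>2 + 2 * r * cos \<phi>1 + 1 \<noteq> 0" "r\<^sup>2 + 2 * r * cos \<phi>2 + 1 \<noteq> 0"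
  shows "ml_K4 \<rho> \<mu> r \<phi>1 \<phi>2 z = ml_K' \<rho> \<mu> r \<phi>2 z - ml_K' \<rho> \<mu> r \<phi>1 z"
proof -
  define d1 where "d1 = complex_of_real (r\<^sup>2 + 2 * r * cos \<phi>1 + 1)"
  define d2 where "d2 = complex_of_real (r\<^sup>2 + 2 * r * cos \<phi>2 + 1)"
  define g where "g \<phi> = exp (zpow z r (of_real \<rho>) * exp (- \<i> * of_real (\<rho> * pi)) * of_real (cos (\<rho> * \<phi>)))
     * exp (\<i> * ml_eta \<rho> \<mu> r \<phi> z) * (of_real r + exp (\<i> * of_real \<phi>))" for \<phi>
  define V where "V = zpow z r (of_real \<rho> * (1 - \<mu>)) * exp (- \<i> * of_real (\<rho> * pi) * (1 - \<mu>))"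
  have d: "d1 \<noteq> 0" "d2 \<noteq> 0" using assms unfolding d1_def d2_def of_real_eq_0_iff by auto
  have K': "ml_K' \<rho> \<mu> r \<phi> z = of_real \<rho> / (2 * of_real pi * \<i>) * (V * (g \<phi> / of_real (r\<^sup>2 + 2 * r * cos \<phi> + 1)))" for \<phi>
  proof -
    have "exp (\<i> * (ml_eta \<rho> \<mu> r \<phi> z - of_real (pi * \<rho>) * (1 - \<mu>))) = exp (\<i> * ml_eta \<rho> \<mu> r \<phi> z) * exp (- \<i> * of_real (\<rho> * pi) * (1 - \<mu>))"
      by (simp add: algebra_simps flip: exp_add)
    then show ?thesis by (simp add: ml_K'_def g_def V_def mult_ac)
  qed
  have "ml_K4 \<rho> \<mu> r \<phi>1 \<phi>2 z = of_real \<rho> / (2 * of_real pi * \<i>) * (V * (g \<phi>2 * d1 - g \<phi>1 * d2)) / (d1 * d2)"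
    by (simp add: ml_K4_def ml_A_def g_def V_def d1_def d2_def mult_ac)
  also have "\<dots> = of_real \<rho> / (2 * of_real pi * \<i>) * (V * ((g \<phi>2 * d1 - g \<phi>1 * d2) / (d1 * d2)))"
    by simp
  also have "(g \<phi>2 * d1 - g \<phi>1 * d2) / (d1 * d2) = g \<phi>2 / d2 - g \<phi>1 / d1"
    using d by (simp add: diff_divide_distrib)
  finally have "ml_K4 \<rho> \<mu> r \<phi>1 \<phi>2 z = of_real \<rho> / (2 * of_real pi * \<i>) * (V * (g \<phi>2 / d2)) - of_real \<rho> / (2 * of_real pi * \<i>) * (V * (g \<phi>1 / d1))"
    by (simp only: right_diff_distrib)
  then show ?thesis by (simp only: K' d1_def d2_def)
qed

text \<open>
  Changing the sign of \<open>\<phi>\<close> changes the sign of \<open>\<eta>\<close> and preserves the denominator, so the two ray kernels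
  combine to the sines of the three-argument kernel.
\<close>
lemma ml_K3_eq_diff: "ml_K3 \<rho> \<mu> r \<phi> z = ml_K' \<rho> \<mu> r \<phi> z - ml_K' \<rho> \<mu> r (- \<phi>) z"
proof -
  define \<eta> where "\<eta> = ml_eta \<rho> \<mu> r \<phi> z"
  define D where "D = complex_of_real (r\<^sup>2 + 2 * r * cos \<phi> + 1)"
  define C where "C = exp (zpow z r (of_real \<rho>) * exp (- \<i> * of_real (pi * \<rho>)) * of_real (cos (\<rho> * \<phi>)))"
  define V where "V = zpow z r (of_real \<rho> * (1 - \<mu>)) * exp (- \<i> * of_real (pi * \<rho>) * (1 - \<mu>))"
  have \<eta>: "ml_eta \<rho> \<mu> r (- \<phi>) z = - \<eta>" by (simp add: \<eta>_def ml_eta_def)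
  have split: "exp (\<i> * (h - of_real (pi * \<rho>) * (1 - \<mu>))) = exp (\<i> * h) * exp (- \<i> * of_real (pi * \<rho>) * (1 - \<mu>))" for h
    by (simp add: algebra_simps flip: exp_add)
  have K'_pos: "ml_K' \<rho> \<mu> r \<phi> z = of_real \<rho> / (2 * of_real pi * \<i>) * (C * V / D) * (exp (\<i> * \<eta>) * (of_real r + exp (\<i> * of_real \<phi>)))"
    unfolding ml_K'_def split by (simp add: C_def V_def D_def \<eta>_def mult_ac)
  have K'_neg: "ml_K' \<rho> \<mu> r (- \<phi>) z = of_real \<rho> / (2 * of_real pi * \<i>) * (C * V / D) * (exp (- (\<i> * \<eta>)) * (of_real r + exp (- (\<i> * of_real \<phi>))))"
    unfolding ml_K'_def \<eta> split by (simp add: C_def V_def D_def mult_ac)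
  have "exp (\<i> * \<eta>) * (of_real r + exp (\<i> * of_real \<phi>)) - exp (- (\<i> * \<eta>)) * (of_real r + exp (- (\<i> * of_real \<phi>)))
      = 2 * \<i> * (of_real r * sin \<eta> + sin (\<eta> + of_real \<phi>))"
    by (simp add: sin_exp_eq algebra_simps exp_add exp_diff exp_minus field_simps)
  then have "ml_K' \<rho> \<mu> r \<phi> z - ml_K' \<rho> \<mu> r (- \<phi>) z = of_real \<rho> / (2 * of_real pi * \<i>) * (C * V / D) * (2 * \<i> * (of_real r * sin \<eta> + sin (\<eta> + of_real \<phi>)))"
    unfolding K'_pos K'_neg by (simp only: right_diff_distrib[symmetric])
  also have "\<dots> = of_real (\<rho> / pi) * V * C * (of_real r * sin \<eta> + sin (\<eta> + of_real \<phi>)) / D"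
    by simp
  also have "\<dots> = ml_K3 \<rho> \<mu> r \<phi> z"
    by (simp add: ml_K3_def zpow_rot_def V_def C_def D_def \<eta>_def mult_ac)
  finally show ?thesis by simp
qed

section \<open>Integrals over rays and indented rays\<close>
lemma ml_K'_has_integral_0_infinity:
  assumes "z \<noteq> 0" "- pi < \<phi>" "\<phi> < pi"
    and \<Phi>: "\<And>s. s \<in> cut_plane z \<Longrightarrow> (\<Phi> has_field_derivative ml_form \<rho> \<mu> z s) (at s)"
    and lim0: "((\<lambda>x. \<Phi> (Complex x (Arg2pi z - pi + \<phi>))) \<longlongrightarrow> L0) at_bot"
    and lim: "((\<lambda>x. \<Phi> (Complex x (Arg2pi z - pi + \<phi>))) \<longlongrightarrow> L) at_top"
  shows "((\<lambda>r. ml_K' \<rho> \<mu> r \<phi> z) has_integral (of_real \<rho> / (2 * of_real pi * \<i>) * L - of_real \<rho> / (2 * of_real pi * \<i>) * L0)) {0<..}"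
  by (rule has_integral_FTC_0_infinity[OF
        ml_K'_primitive[OF assms(1) _ ray_point_in_cut_plane_angle[OF assms(2,3)] \<Phi>]
        ray_tendsto_at_right_0[OF assms(1) lim0] ray_tendsto_at_top[OF assms(1) lim]])

lemma ml_K'_has_integral_upto:
  assumes "z \<noteq> 0" "0 < c" "c < 1"
    and \<Phi>: "\<And>s. s \<in> cut_plane z \<Longrightarrow> (\<Phi> has_field_derivative ml_form \<rho> \<mu> z s) (at s)"
    and lim0: "((\<lambda>x. \<Phi> (Complex x (Arg2pi z - pi + \<phi>))) \<longlongrightarrow> L0) at_bot"
  shows "((\<lambda>r. ml_K' \<rho> \<mu> r \<phi> z) has_integral
     (of_real \<rho> / (2 * of_real pi * \<i>) * \<Phi> (ray_point z \<phi> c) - of_real \<rho> / (2 * of_real pi * \<i>) * L0)) {0<..c}"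
proof (rule has_integral_FTC_at_right_0[OF assms(2) _ ray_tendsto_at_right_0[OF assms(1) lim0]])
  fix r :: real assume "0 < r" "r \<le> c"
  then show "((\<lambda>r. of_real \<rho> / (2 * of_real pi * \<i>) * \<Phi> (ray_point z \<phi> r)) has_vector_derivative ml_K' \<rho> \<mu> r \<phi> z) (at r)"
    using assms(1,3) by (intro ml_K'_primitive \<Phi> ray_point_in_cut_plane_radius) auto
qed

lemma ml_K'_has_integral_from:
  assumes "z \<noteq> 0" "1 < c"
    and \<Phi>: "\<And>s. s \<in> cut_plane z \<Longrightarrow> (\<Phi> has_field_derivative ml_form \<rho> \<mu> z s) (at s)"
    and lim: "((\<lambda>x. \<Phi> (Complex x (Arg2pi z - pi + \<phi>))) \<longlongrightarrow> L) at_top"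
  shows "((\<lambda>r. ml_K' \<rho> \<mu> r \<phi> z) has_integral
     (of_real \<rho> / (2 * of_real pi * \<i>) * L - of_real \<rho> / (2 * of_real pi * \<i>) * \<Phi> (ray_point z \<phi> c))) {c..}"
proof (rule has_integral_FTC_at_top[OF _ ray_tendsto_at_top[OF assms(1) lim]])
  fix r :: real assume "c \<le> r"
  then show "((\<lambda>r. of_real \<rho> / (2 * of_real pi * \<i>) * \<Phi> (ray_point z \<phi> r)) has_vector_derivative ml_K' \<rho> \<mu> r \<phi> z) (at r)"
    using assms(1,2) by (intro ml_K'_primitive \<Phi> ray_point_in_cut_plane_radius) auto
qed

text \<open>
  The pieces of the upper contour that avoids the pole at \<open>log z\<close>. The values of \<open>\<Phi>\<close> at the two end points
  of the arc cancel in the sum, which does not depend on \<open>\<epsilon>\<close>.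
\<close>
lemma indented_upper_ray_integrals:
  assumes z: "z \<noteq> 0" and \<epsilon>: "0 < \<epsilon>" "\<epsilon> < 1"
    and \<Phi>: "\<And>s. s \<in> cut_plane z \<Longrightarrow> (\<Phi> has_field_derivative ml_form \<rho> \<mu> z s) (at s)"
    and L0: "((\<lambda>x. \<Phi> (Complex x (Arg2pi z))) \<longlongrightarrow> L0) at_bot"
    and Lp: "((\<lambda>x. \<Phi> (Complex x (Arg2pi z))) \<longlongrightarrow> Lp) at_top"
  defines "\<kappa> \<equiv> complex_of_real \<rho> / (2 * of_real pi * \<i>)"
  shows "((\<lambda>r. ml_K' \<rho> \<mu> r pi z) has_integral (\<kappa> * \<Phi> (ray_point z pi (1 - \<epsilon>)) - \<kappa> * L0)) {0<..1 - \<epsilon>}"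
    and "((\<lambda>r. ml_K' \<rho> \<mu> r pi z) has_integral (\<kappa> * Lp - \<kappa> * \<Phi> (ray_point z pi (1 + \<epsilon>)))) {1 + \<epsilon>..}"
    and "((\<lambda>\<psi>. ml_P' \<rho> \<mu> \<epsilon> \<psi> 0 z) has_integral
      (\<kappa> * \<Phi> (ray_point z pi (1 + \<epsilon>)) - \<kappa> * \<Phi> (ray_point z pi (1 - \<epsilon>)))) {- pi..0}"
proof -
  have line: "Arg2pi z - pi + pi = Arg2pi z" by simp
  have L0': "((\<lambda>x. \<Phi> (Complex x (Arg2pi z - pi + pi))) \<longlongrightarrow> L0) at_bot"
    and Lp': "((\<lambda>x. \<Phi> (Complex x (Arg2pi z - pi + pi))) \<longlongrightarrow> Lp) at_top"
    unfolding line by (fact L0, fact Lp)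
  show "((\<lambda>r. ml_K' \<rho> \<mu> r pi z) has_integral (\<kappa> * \<Phi> (ray_point z pi (1 - \<epsilon>)) - \<kappa> * L0)) {0<..1 - \<epsilon>}"
    unfolding \<kappa>_def by (rule ml_K'_has_integral_upto[OF z _ _ \<Phi> L0']) (use \<epsilon> in auto)
  show "((\<lambda>r. ml_K' \<rho> \<mu> r pi z) has_integral (\<kappa> * Lp - \<kappa> * \<Phi> (ray_point z pi (1 + \<epsilon>)))) {1 + \<epsilon>..}"
    unfolding \<kappa>_def by (rule ml_K'_has_integral_from[OF z _ \<Phi> Lp']) (use \<epsilon> in auto)
  have "((\<lambda>\<psi>. ml_P' \<rho> \<mu> \<epsilon> \<psi> 0 z) has_integral
      (\<kappa> * \<Phi> (arc_point z \<epsilon> 0 0) - \<kappa> * \<Phi> (arc_point z \<epsilon> 0 (- pi)))) {- pi..0}"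
    unfolding \<kappa>_def using \<epsilon> by (intro ml_P'_has_integral[OF z] \<Phi> arc_point_in_cut_plane[OF z]) auto
  moreover have "exp (\<i> * complex_of_real (- pi)) = of_real (- 1)" "exp (\<i> * complex_of_real 0) = of_real 1"
    by (simp_all add: complex_eq_iff Re_exp Im_exp)
  ultimately show "((\<lambda>\<psi>. ml_P' \<rho> \<mu> \<epsilon> \<psi> 0 z) has_integral
      (\<kappa> * \<Phi> (ray_point z pi (1 + \<epsilon>)) - \<kappa> * \<Phi> (ray_point z pi (1 - \<epsilon>)))) {- pi..0}"
    using arc_point_end[OF z \<epsilon>, of "- pi" "- 1" 0] arc_point_end[OF z \<epsilon>, of 0 1 0] by simp
qed

text \<open>
  The counterpart at the pole \<open>log z - 2 \<pi> \<i>\<close>. Here the arc runs from right to left, so its integral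
  has to be subtracted from those along the ray.
\<close>
lemma indented_lower_ray_integrals:
  assumes z: "z \<noteq> 0" and \<epsilon>: "0 < \<epsilon>" "\<epsilon> < 1"
    and \<Phi>: "\<And>s. s \<in> cut_plane z \<Longrightarrow> (\<Phi> has_field_derivative ml_form \<rho> \<mu> z s) (at s)"
    and L0: "((\<lambda>x. \<Phi> (Complex x (Arg2pi z - 2 * pi))) \<longlongrightarrow> L0) at_bot"
    and Lm: "((\<lambda>x. \<Phi> (Complex x (Arg2pi z - 2 * pi))) \<longlongrightarrow> Lm) at_top"
  defines "\<kappa> \<equiv> complex_of_real \<rho> / (2 * of_real pi * \<i>)"
  shows "((\<lambda>r. ml_K' \<rho> \<mu> r (- pi) z) has_integral (\<kappa> * \<Phi> (ray_point z (- pi) (1 - \<epsilon>)) - \<kappa> * L0)) {0<..1 - \<epsilon>}"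
    and "((\<lambda>r. ml_K' \<rho> \<mu> r (- pi) z) has_integral (\<kappa> * Lm - \<kappa> * \<Phi> (ray_point z (- pi) (1 + \<epsilon>)))) {1 + \<epsilon>..}"
    and "((\<lambda>\<psi>. ml_P' \<rho> \<mu> \<epsilon> \<psi> (- 2) z) has_integral
      (\<kappa> * \<Phi> (ray_point z (- pi) (1 - \<epsilon>)) - \<kappa> * \<Phi> (ray_point z (- pi) (1 + \<epsilon>)))) {- 2 * pi..- pi}"
proof -
  have line: "Arg2pi z - pi + - pi = Arg2pi z - 2 * pi" by simp
  have L0': "((\<lambda>x. \<Phi> (Complex x (Arg2pi z - pi + - pi))) \<longlongrightarrow> L0) at_bot"
    and Lm': "((\<lambda>x. \<Phi> (Complex x (Arg2pi z - pi + - pi))) \<longlongrightarrow> Lm) at_top"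
    unfolding line by (fact L0, fact Lm)
  show "((\<lambda>r. ml_K' \<rho> \<mu> r (- pi) z) has_integral (\<kappa> * \<Phi> (ray_point z (- pi) (1 - \<epsilon>)) - \<kappa> * L0)) {0<..1 - \<epsilon>}"
    unfolding \<kappa>_def by (rule ml_K'_has_integral_upto[OF z _ _ \<Phi> L0']) (use \<epsilon> in auto)
  show "((\<lambda>r. ml_K' \<rho> \<mu> r (- pi) z) has_integral (\<kappa> * Lm - \<kappa> * \<Phi> (ray_point z (- pi) (1 + \<epsilon>)))) {1 + \<epsilon>..}"
    unfolding \<kappa>_def by (rule ml_K'_has_integral_from[OF z _ \<Phi> Lm']) (use \<epsilon> in auto)
  have "((\<lambda>\<psi>. ml_P' \<rho> \<mu> \<epsilon> \<psi> (- 2) z) has_integral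
      (\<kappa> * \<Phi> (arc_point z \<epsilon> (- 2) (- pi)) - \<kappa> * \<Phi> (arc_point z \<epsilon> (- 2) (- 2 * pi)))) {- 2 * pi..- pi}"
    unfolding \<kappa>_def using \<epsilon> by (intro ml_P'_has_integral[OF z] \<Phi> arc_point_in_cut_plane[OF z]) auto
  moreover have "exp (\<i> * complex_of_real (- pi)) = of_real (- 1)" "exp (\<i> * complex_of_real (- 2 * pi)) = of_real 1"
    by (simp_all add: complex_eq_iff Re_exp Im_exp)
  ultimately show "((\<lambda>\<psi>. ml_P' \<rho> \<mu> \<epsilon> \<psi> (- 2) z) has_integral
      (\<kappa> * \<Phi> (ray_point z (- pi) (1 - \<epsilon>)) - \<kappa> * \<Phi> (ray_point z (- pi) (1 + \<epsilon>)))) {- 2 * pi..- pi}"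
    using arc_point_end[OF z \<epsilon>, of "- pi" "- 1" "- 2"] arc_point_end[OF z \<epsilon>, of "- 2 * pi" 1 "- 2"] by simp
qed

section \<open>The integral representations\<close>

text \<open>
  The three limits to which every contour integral below is reduced. Since \<open>\<pi> / (2 \<rho>) = q\<close> gives
  \<open>\<rho> q = \<pi> / 2\<close>, the strips \<open>q < y < 3 q\<close> and \<open>- 3 q < y < - q\<close> are exactly the components of
  \<open>cos (\<rho> y) < 0\<close> that are nearest to the real axis.
\<close>
lemma mittag_leffler_eq_jump:
  assumes "\<rho> > 1 / 2" "Re \<mu> < 1 + 1 / \<rho>" "z \<noteq> 0"
  obtains \<Phi> L0 Lp Lm where
    "\<And>s. s \<in> cut_plane z \<Longrightarrow> (\<Phi> has_field_derivative ml_form \<rho> \<mu> z s) (at s)"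
    "\<And>y. ((\<lambda>x. \<Phi> (Complex x y)) \<longlongrightarrow> L0) at_bot"
    "\<And>y. pi / (2 * \<rho>) < y \<Longrightarrow> y < 3 * (pi / (2 * \<rho>)) \<Longrightarrow> ((\<lambda>x. \<Phi> (Complex x y)) \<longlongrightarrow> Lp) at_top"
    "\<And>y. - 3 * (pi / (2 * \<rho>)) < y \<Longrightarrow> y < - (pi / (2 * \<rho>)) \<Longrightarrow> ((\<lambda>x. \<Phi> (Complex x y)) \<longlongrightarrow> Lm) at_top"
    "mittag_leffler \<rho> \<mu> z = of_real \<rho> / (2 * of_real pi * \<i>) * Lp - of_real \<rho> / (2 * of_real pi * \<i>) * Lm"
proof -
  define q where "q = pi / (2 * \<rho>)"
  have "\<rho> > 0" using assms(1) by simp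
  then have q: "q > 0" "\<rho> * q = pi / 2" by (auto simp: q_def)
  have cos_neg: "cos (\<rho> * y) < 0" if "q < y" "y < 3 * q" for y
  proof -
    have "\<rho> * q < \<rho> * y" "\<rho> * y < \<rho> * (3 * q)"
      using that \<open>\<rho> > 0\<close> by simp_all
    moreover have "\<rho> * (3 * q) = 3 * (pi / 2)" using q(2) by simp
    ultimately have "cos (\<rho> * y - pi) > 0" using q(2) by (intro cos_gt_zero_pi) linarith+
    then show ?thesis by simp
  qed
  have cos_neg': "cos (\<rho> * y) < 0" if "- 3 * q < y" "y < - q" for y
    using cos_neg[of "- y"] that by simp
  obtain \<Phi> where \<Phi>: "\<And>s. s \<in> cut_plane z \<Longrightarrow> (\<Phi> has_field_derivative ml_form \<rho> \<mu> z s) (at s)"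
    using ml_form_has_primitive[OF assms(3)] by blast
  obtain L0 where L0: "\<And>y. ((\<lambda>x. \<Phi> (Complex x y)) \<longlongrightarrow> L0) at_bot"
    using ml_primitive_limit_at_bot[OF \<open>\<rho> > 0\<close> assms(3,2) \<Phi>] by blast
  have "\<exists>L. \<forall>y\<in>{q<..<3 * q}. ((\<lambda>x. \<Phi> (Complex x y)) \<longlongrightarrow> L) at_top"
    by (rule ml_primitive_limit_at_top[OF \<open>\<rho> > 0\<close> assms(3) is_interval_oo _ \<Phi>]) (auto intro: cos_neg)
  then obtain Lp where "\<forall>y\<in>{q<..<3 * q}. ((\<lambda>x. \<Phi> (Complex x y)) \<longlongrightarrow> Lp) at_top" ..
  then have Lp: "((\<lambda>x. \<Phi> (Complex x y)) \<longlongrightarrow> Lp) at_top" if "q < y" "y < 3 * q" for y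
    using that by (simp only: greaterThanLessThan_iff)
  have "\<exists>L. \<forall>y\<in>{- 3 * q<..<- q}. ((\<lambda>x. \<Phi> (Complex x y)) \<longlongrightarrow> L) at_top"
    by (rule ml_primitive_limit_at_top[OF \<open>\<rho> > 0\<close> assms(3) is_interval_oo _ \<Phi>]) (auto intro: cos_neg')
  then obtain Lm where "\<forall>y\<in>{- 3 * q<..<- q}. ((\<lambda>x. \<Phi> (Complex x y)) \<longlongrightarrow> Lm) at_top" ..
  then have Lm: "((\<lambda>x. \<Phi> (Complex x y)) \<longlongrightarrow> Lm) at_top" if "- 3 * q < y" "y < - q" for y
    using that by (simp only: greaterThanLessThan_iff)
  have mid: "pi / \<rho> = 2 * q" by (simp add: q_def)
  have "(\<lambda>k. z ^ k * rGamma (\<mu> + of_real (real k / \<rho>))) sums (of_real \<rho> / (2 * of_real pi * \<i>) * (Lp - Lm))"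
    by (rule mittag_leffler_sums_jump[OF \<open>\<rho> > 0\<close> assms(3) \<Phi>])
      (use q(1) in \<open>auto simp: mid minus_divide_left[symmetric] intro!: Lp Lm\<close>)
  then have "mittag_leffler \<rho> \<mu> z = of_real \<rho> / (2 * of_real pi * \<i>) * (Lp - Lm)"
    unfolding mittag_leffler_def by (simp only: sums_iff)
  then have "mittag_leffler \<rho> \<mu> z = of_real \<rho> / (2 * of_real pi * \<i>) * Lp - of_real \<rho> / (2 * of_real pi * \<i>) * Lm"
    by (simp only: right_diff_distrib)
  from that[OF \<Phi> L0 Lp[unfolded q_def] Lm[unfolded q_def] this] show ?thesis .
qed

lemma ray_denominator_nonzero:
  fixes r \<phi> :: real
  assumes "r > 0" "- pi < \<phi>" "\<phi> < pi"
  shows "r\<^sup>2 + 2 * r * cos \<phi> + 1 \<noteq> 0"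
proof -
  have "- 1 < cos \<phi>"
    using cos_monotone_0_pi[of "\<bar>\<phi>\<bar>" pi] assms(2,3) by simp
  then have "2 * r * (- 1) < 2 * r * cos \<phi>"
    using assms(1) by (intro mult_strict_left_mono) auto
  moreover have "0 \<le> (r - 1)\<^sup>2" by simp
  ultimately show ?thesis by (simp add: power2_diff)
qed

theorem theorem3:
  fixes \<rho> :: real and \<mu> :: complex
  assumes "\<rho> > 1 / 2" and "Re \<mu> < 1 + 1 / \<rho>"
  shows
   "(\<forall>\<delta>1 \<delta>2 :: real. \<forall>z :: complex.
       (\<rho> > 1 \<longrightarrow> pi / (2 * \<rho>) < \<delta>1 \<and> \<delta>1 \<le> pi / \<rho> \<and> pi / (2 * \<rho>) < \<delta>2 \<and> \<delta>2 \<le> pi / \<rho>) \<and>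
       (\<rho> \<le> 1 \<longrightarrow> pi / (2 * \<rho>) < \<delta>1 \<and> \<delta>1 < pi \<and> pi / (2 * \<rho>) < \<delta>2 \<and> \<delta>2 < pi) \<and>
       z \<noteq> 0 \<and>
       pi / (2 * \<rho>) - \<delta>2 + pi < Arg2pi z \<and> Arg2pi z < - pi / (2 * \<rho>) + \<delta>1 + pi
       \<longrightarrow> (\<lambda>r. ml_K4 \<rho> \<mu> r (- \<delta>1) \<delta>2 z) integrable_on {0<..} \<and>
           mittag_leffler \<rho> \<mu> z = integral {0<..} (\<lambda>r. ml_K4 \<rho> \<mu> r (- \<delta>1) \<delta>2 z))
    \<and>
    (\<forall>\<delta>2 \<epsilon>1 :: real. \<forall>z :: complex.
       \<rho> \<le> 1 \<and> pi / (2 * \<rho>) < \<delta>2 \<and> \<delta>2 < pi \<and>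
       z \<noteq> 0 \<and>
       pi / (2 * \<rho>) - \<delta>2 + pi < Arg2pi z \<and> Arg2pi z < - pi / (2 * \<rho>) + 2 * pi \<and>
       0 < \<epsilon>1 \<and> \<epsilon>1 < 1
       \<longrightarrow> (\<lambda>r. ml_K' \<rho> \<mu> r \<delta>2 z) integrable_on {0<..} \<and>
           (\<lambda>r. ml_K' \<rho> \<mu> r (- pi) z) integrable_on {0<..1 - \<epsilon>1} \<and>
           (\<lambda>r. ml_K' \<rho> \<mu> r (- pi) z) integrable_on {1 + \<epsilon>1..} \<and>
           (\<lambda>\<psi>. ml_P' \<rho> \<mu> \<epsilon>1 \<psi> (- 2) z) integrable_on {- 2 * pi..- pi} \<and>
           mittag_leffler \<rho> \<mu> z =
             integral {0<..} (\<lambda>r. ml_K' \<rho> \<mu> r \<delta>2 z)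
             - integral {0<..1 - \<epsilon>1} (\<lambda>r. ml_K' \<rho> \<mu> r (- pi) z)
             - integral {1 + \<epsilon>1..} (\<lambda>r. ml_K' \<rho> \<mu> r (- pi) z)
             + integral {- 2 * pi..- pi} (\<lambda>\<psi>. ml_P' \<rho> \<mu> \<epsilon>1 \<psi> (- 2) z))
    \<and>
    (\<forall>\<delta>1 \<epsilon>1 :: real. \<forall>z :: complex.
       \<rho> \<le> 1 \<and> pi / (2 * \<rho>) < \<delta>1 \<and> \<delta>1 < pi \<and>
       z \<noteq> 0 \<and>
       pi / (2 * \<rho>) < Arg2pi z \<and> Arg2pi z < - pi / (2 * \<rho>) + \<delta>1 + pi \<and>
       0 < \<epsilon>1 \<and> \<epsilon>1 < 1
       \<longrightarrow> (\<lambda>r. ml_K' \<rho> \<mu> r pi z) integrable_on {0<..1 - \<epsilon>1} \<and>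
           (\<lambda>r. ml_K' \<rho> \<mu> r pi z) integrable_on {1 + \<epsilon>1..} \<and>
           (\<lambda>\<psi>. ml_P' \<rho> \<mu> \<epsilon>1 \<psi> 0 z) integrable_on {- pi..0} \<and>
           (\<lambda>r. ml_K' \<rho> \<mu> r (- \<delta>1) z) integrable_on {0<..} \<and>
           mittag_leffler \<rho> \<mu> z =
             integral {0<..1 - \<epsilon>1} (\<lambda>r. ml_K' \<rho> \<mu> r pi z)
             + integral {1 + \<epsilon>1..} (\<lambda>r. ml_K' \<rho> \<mu> r pi z)
             + integral {- pi..0} (\<lambda>\<psi>. ml_P' \<rho> \<mu> \<epsilon>1 \<psi> 0 z)
             - integral {0<..} (\<lambda>r. ml_K' \<rho> \<mu> r (- \<delta>1) z))
    \<and>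
    (\<forall>\<epsilon>1 :: real. \<forall>z :: complex.
       \<rho> \<le> 1 \<and>
       z \<noteq> 0 \<and>
       pi / (2 * \<rho>) < Arg2pi z \<and> Arg2pi z < - pi / (2 * \<rho>) + 2 * pi \<and>
       0 < \<epsilon>1 \<and> \<epsilon>1 < 1
       \<longrightarrow> (\<lambda>r. ml_K3 \<rho> \<mu> r pi z) integrable_on {0<..1 - \<epsilon>1} \<and>
           (\<lambda>r. ml_K3 \<rho> \<mu> r pi z) integrable_on {1 + \<epsilon>1..} \<and>
           (\<lambda>\<psi>. ml_P' \<rho> \<mu> \<epsilon>1 \<psi> 0 z) integrable_on {- pi..0} \<and>
           (\<lambda>\<psi>. ml_P' \<rho> \<mu> \<epsilon>1 \<psi> (- 2) z) integrable_on {- 2 * pi..- pi} \<and>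
           mittag_leffler \<rho> \<mu> z =
             integral {0<..1 - \<epsilon>1} (\<lambda>r. ml_K3 \<rho> \<mu> r pi z)
             + integral {1 + \<epsilon>1..} (\<lambda>r. ml_K3 \<rho> \<mu> r pi z)
             + integral {- pi..0} (\<lambda>\<psi>. ml_P' \<rho> \<mu> \<epsilon>1 \<psi> 0 z)
             + integral {- 2 * pi..- pi} (\<lambda>\<psi>. ml_P' \<rho> \<mu> \<epsilon>1 \<psi> (- 2) z))"
proof (intro conjI allI impI)
  have "\<rho> > 0" using assms(1) by simp
  define q where "q = pi / (2 * \<rho>)"
  have q: "pi / \<rho> = 2 * q" "- pi / (2 * \<rho>) = - q" "q > 0"
    using \<open>\<rho> > 0\<close> by (simp_all add: q_def)
  have q_pi: "pi \<le> 2 * q" if "\<rho> \<le> 1"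
    using that \<open>\<rho> > 0\<close> by (simp add: q_def field_simps)
  have q_pi': "2 * q < pi" if "\<rho> > 1"
    using that by (simp add: q_def field_simps)
  define \<kappa> where "\<kappa> = complex_of_real \<rho> / (2 * of_real pi * \<i>)"
  {
    fix \<delta>1 \<delta>2 :: real and z :: complex
    assume *: "(\<rho> > 1 \<longrightarrow> pi / (2 * \<rho>) < \<delta>1 \<and> \<delta>1 \<le> pi / \<rho> \<and> pi / (2 * \<rho>) < \<delta>2 \<and> \<delta>2 \<le> pi / \<rho>) \<and>
       (\<rho> \<le> 1 \<longrightarrow> pi / (2 * \<rho>) < \<delta>1 \<and> \<delta>1 < pi \<and> pi / (2 * \<rho>) < \<delta>2 \<and> \<delta>2 < pi) \<and>
       z \<noteq> 0 \<and>
       pi / (2 * \<rho>) - \<delta>2 + pi < Arg2pi z \<and> Arg2pi z < - pi / (2 * \<rho>) + \<delta>1 + pi"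
    then have z: "z \<noteq> 0" by blast
    \<comment> \<open>Both cases of the hypothesis give the same two bounds: \<open>2 q = \<pi> / \<rho>\<close> is below \<open>\<pi>\<close> exactly for \<open>\<rho> > 1\<close>.\<close>
    have \<delta>: "q < \<delta>1" "\<delta>1 \<le> 2 * q" "\<delta>1 < pi" "q < \<delta>2" "\<delta>2 \<le> 2 * q" "\<delta>2 < pi"
      using * q_pi q_pi' unfolding q q_def[symmetric] by (cases "\<rho> > 1"; simp)+
    have arg: "q - \<delta>2 + pi < Arg2pi z" "Arg2pi z < - q + \<delta>1 + pi"
      using * unfolding q q_def[symmetric] by blast+
    obtain \<Phi> L0 Lp Lm where
      \<Phi>: "\<And>s. s \<in> cut_plane z \<Longrightarrow> (\<Phi> has_field_derivative ml_form \<rho> \<mu> z s) (at s)" and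
      L0: "\<And>y. ((\<lambda>x. \<Phi> (Complex x y)) \<longlongrightarrow> L0) at_bot" and
      Lp: "\<And>y. q < y \<Longrightarrow> y < 3 * q \<Longrightarrow> ((\<lambda>x. \<Phi> (Complex x y)) \<longlongrightarrow> Lp) at_top" and
      Lm: "\<And>y. - 3 * q < y \<Longrightarrow> y < - q \<Longrightarrow> ((\<lambda>x. \<Phi> (Complex x y)) \<longlongrightarrow> Lm) at_top" and
      E: "mittag_leffler \<rho> \<mu> z = \<kappa> * Lp - \<kappa> * Lm"
      using mittag_leffler_eq_jump[OF assms z] unfolding q_def \<kappa>_def by metis
    have upper: "((\<lambda>r. ml_K' \<rho> \<mu> r \<delta>2 z) has_integral (\<kappa> * Lp - \<kappa> * L0)) {0<..}"
      unfolding \<kappa>_def by (rule ml_K'_has_integral_0_infinity[OF z _ _ \<Phi> L0 Lp]) (use \<delta> arg q(3) in linarith)+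
    have lower: "((\<lambda>r. ml_K' \<rho> \<mu> r (- \<delta>1) z) has_integral (\<kappa> * Lm - \<kappa> * L0)) {0<..}"
      unfolding \<kappa>_def by (rule ml_K'_has_integral_0_infinity[OF z _ _ \<Phi> L0 Lm]) (use \<delta> arg q(3) in linarith)+
    have "((\<lambda>r. ml_K4 \<rho> \<mu> r (- \<delta>1) \<delta>2 z) has_integral mittag_leffler \<rho> \<mu> z) {0<..}"
    proof (rule has_integral_eq)
      show "((\<lambda>r. ml_K' \<rho> \<mu> r \<delta>2 z - ml_K' \<rho> \<mu> r (- \<delta>1) z) has_integral mittag_leffler \<rho> \<mu> z) {0<..}"
        using has_integral_diff[OF upper lower] by (simp add: E)
      fix r :: real assume "r \<in> {0<..}"
      then show "ml_K' \<rho> \<mu> r \<delta>2 z - ml_K' \<rho> \<mu> r (- \<delta>1) z = ml_K4 \<rho> \<mu> r (- \<delta>1) \<delta>2 z"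
        using \<delta> q(3) by (intro ml_K4_eq_diff[symmetric] ray_denominator_nonzero) auto
    qed
    then show "(\<lambda>r. ml_K4 \<rho> \<mu> r (- \<delta>1) \<delta>2 z) integrable_on {0<..}"
      "mittag_leffler \<rho> \<mu> z = integral {0<..} (\<lambda>r. ml_K4 \<rho> \<mu> r (- \<delta>1) \<delta>2 z)"
      by (auto simp: has_integral_iff)
  next
    fix \<delta>2 \<epsilon> :: real and z :: complex
    assume *: "\<rho> \<le> 1 \<and> pi / (2 * \<rho>) < \<delta>2 \<and> \<delta>2 < pi \<and>
       z \<noteq> 0 \<and>
       pi / (2 * \<rho>) - \<delta>2 + pi < Arg2pi z \<and> Arg2pi z < - pi / (2 * \<rho>) + 2 * pi \<and>
       0 < \<epsilon> \<and> \<epsilon> < 1"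
    then have z: "z \<noteq> 0" and \<epsilon>: "0 < \<epsilon>" "\<epsilon> < 1" by blast+
    have \<delta>: "q < \<delta>2" "\<delta>2 < pi" "pi \<le> 2 * q"
      and arg: "q - \<delta>2 + pi < Arg2pi z" "Arg2pi z < - q + 2 * pi"
      using * q_pi unfolding q q_def[symmetric] by blast+
    obtain \<Phi> L0 Lp Lm where
      \<Phi>: "\<And>s. s \<in> cut_plane z \<Longrightarrow> (\<Phi> has_field_derivative ml_form \<rho> \<mu> z s) (at s)" and
      L0: "\<And>y. ((\<lambda>x. \<Phi> (Complex x y)) \<longlongrightarrow> L0) at_bot" and
      Lp: "\<And>y. q < y \<Longrightarrow> y < 3 * q \<Longrightarrow> ((\<lambda>x. \<Phi> (Complex x y)) \<longlongrightarrow> Lp) at_top" and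
      Lm: "\<And>y. - 3 * q < y \<Longrightarrow> y < - q \<Longrightarrow> ((\<lambda>x. \<Phi> (Complex x y)) \<longlongrightarrow> Lm) at_top" and
      E: "mittag_leffler \<rho> \<mu> z = \<kappa> * Lp - \<kappa> * Lm"
      using mittag_leffler_eq_jump[OF assms z] unfolding q_def \<kappa>_def by metis
    have upper: "((\<lambda>r. ml_K' \<rho> \<mu> r \<delta>2 z) has_integral (\<kappa> * Lp - \<kappa> * L0)) {0<..}"
      unfolding \<kappa>_def by (rule ml_K'_has_integral_0_infinity[OF z _ _ \<Phi> L0 Lp]) (use \<delta> arg q(3) in linarith)+
    have "((\<lambda>x. \<Phi> (Complex x (Arg2pi z - 2 * pi))) \<longlongrightarrow> Lm) at_top"
      by (rule Lm) (use \<delta> arg q(3) in linarith)+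
    note lower = indented_lower_ray_integrals[OF z \<epsilon> \<Phi> L0 this, folded \<kappa>_def]
    show "(\<lambda>r. ml_K' \<rho> \<mu> r \<delta>2 z) integrable_on {0<..}"
      "(\<lambda>r. ml_K' \<rho> \<mu> r (- pi) z) integrable_on {0<..1 - \<epsilon>}"
      "(\<lambda>r. ml_K' \<rho> \<mu> r (- pi) z) integrable_on {1 + \<epsilon>..}"
      "(\<lambda>\<psi>. ml_P' \<rho> \<mu> \<epsilon> \<psi> (- 2) z) integrable_on {- 2 * pi..- pi}"
      "mittag_leffler \<rho> \<mu> z =
             integral {0<..} (\<lambda>r. ml_K' \<rho> \<mu> r \<delta>2 z)
             - integral {0<..1 - \<epsilon>} (\<lambda>r. ml_K' \<rho> \<mu> r (- pi) z)
             - integral {1 + \<epsilon>..} (\<lambda>r. ml_K' \<rho> \<mu> r (- pi) z)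
             + integral {- 2 * pi..- pi} (\<lambda>\<psi>. ml_P' \<rho> \<mu> \<epsilon> \<psi> (- 2) z)"
      using upper lower by (auto simp: has_integral_iff E)
  next
    fix \<delta>1 \<epsilon> :: real and z :: complex
    assume *: "\<rho> \<le> 1 \<and> pi / (2 * \<rho>) < \<delta>1 \<and> \<delta>1 < pi \<and>
       z \<noteq> 0 \<and>
       pi / (2 * \<rho>) < Arg2pi z \<and> Arg2pi z < - pi / (2 * \<rho>) + \<delta>1 + pi \<and>
       0 < \<epsilon> \<and> \<epsilon> < 1"
    then have z: "z \<noteq> 0" and \<epsilon>: "0 < \<epsilon>" "\<epsilon> < 1" by blast+
    have \<delta>: "q < \<delta>1" "\<delta>1 < pi" "pi \<le> 2 * q"
      and arg: "q < Arg2pi z" "Arg2pi z < - q + \<delta>1 + pi"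
      using * q_pi unfolding q q_def[symmetric] by blast+
    obtain \<Phi> L0 Lp Lm where
      \<Phi>: "\<And>s. s \<in> cut_plane z \<Longrightarrow> (\<Phi> has_field_derivative ml_form \<rho> \<mu> z s) (at s)" and
      L0: "\<And>y. ((\<lambda>x. \<Phi> (Complex x y)) \<longlongrightarrow> L0) at_bot" and
      Lp: "\<And>y. q < y \<Longrightarrow> y < 3 * q \<Longrightarrow> ((\<lambda>x. \<Phi> (Complex x y)) \<longlongrightarrow> Lp) at_top" and
      Lm: "\<And>y. - 3 * q < y \<Longrightarrow> y < - q \<Longrightarrow> ((\<lambda>x. \<Phi> (Complex x y)) \<longlongrightarrow> Lm) at_top" and
      E: "mittag_leffler \<rho> \<mu> z = \<kappa> * Lp - \<kappa> * Lm"
      using mittag_leffler_eq_jump[OF assms z] unfolding q_def \<kappa>_def by metis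
    have lower: "((\<lambda>r. ml_K' \<rho> \<mu> r (- \<delta>1) z) has_integral (\<kappa> * Lm - \<kappa> * L0)) {0<..}"
      unfolding \<kappa>_def by (rule ml_K'_has_integral_0_infinity[OF z _ _ \<Phi> L0 Lm]) (use \<delta> arg q(3) in linarith)+
    have "((\<lambda>x. \<Phi> (Complex x (Arg2pi z))) \<longlongrightarrow> Lp) at_top"
      by (rule Lp) (use \<delta> arg q(3) in linarith)+
    note upper = indented_upper_ray_integrals[OF z \<epsilon> \<Phi> L0 this, folded \<kappa>_def]
    show "(\<lambda>r. ml_K' \<rho> \<mu> r pi z) integrable_on {0<..1 - \<epsilon>}"
      "(\<lambda>r. ml_K' \<rho> \<mu> r pi z) integrable_on {1 + \<epsilon>..}"
      "(\<lambda>\<psi>. ml_P' \<rho> \<mu> \<epsilon> \<psi> 0 z) integrable_on {- pi..0}"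
      "(\<lambda>r. ml_K' \<rho> \<mu> r (- \<delta>1) z) integrable_on {0<..}"
      "mittag_leffler \<rho> \<mu> z =
             integral {0<..1 - \<epsilon>} (\<lambda>r. ml_K' \<rho> \<mu> r pi z)
             + integral {1 + \<epsilon>..} (\<lambda>r. ml_K' \<rho> \<mu> r pi z)
             + integral {- pi..0} (\<lambda>\<psi>. ml_P' \<rho> \<mu> \<epsilon> \<psi> 0 z)
             - integral {0<..} (\<lambda>r. ml_K' \<rho> \<mu> r (- \<delta>1) z)"
      using upper lower by (auto simp: has_integral_iff E)
  next
    fix \<epsilon> :: real and z :: complex
    assume *: "\<rho> \<le> 1 \<and>
       z \<noteq> 0 \<and>
       pi / (2 * \<rho>) < Arg2pi z \<and> Arg2pi z < - pi / (2 * \<rho>) + 2 * pi \<and>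
       0 < \<epsilon> \<and> \<epsilon> < 1"
    then have z: "z \<noteq> 0" and \<epsilon>: "0 < \<epsilon>" "\<epsilon> < 1" by blast+
    have \<delta>: "pi \<le> 2 * q"
      and arg: "q < Arg2pi z" "Arg2pi z < - q + 2 * pi"
      using * q_pi unfolding q q_def[symmetric] by blast+
    obtain \<Phi> L0 Lp Lm where
      \<Phi>: "\<And>s. s \<in> cut_plane z \<Longrightarrow> (\<Phi> has_field_derivative ml_form \<rho> \<mu> z s) (at s)" and
      L0: "\<And>y. ((\<lambda>x. \<Phi> (Complex x y)) \<longlongrightarrow> L0) at_bot" and
      Lp: "\<And>y. q < y \<Longrightarrow> y < 3 * q \<Longrightarrow> ((\<lambda>x. \<Phi> (Complex x y)) \<longlongrightarrow> Lp) at_top" and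
      Lm: "\<And>y. - 3 * q < y \<Longrightarrow> y < - q \<Longrightarrow> ((\<lambda>x. \<Phi> (Complex x y)) \<longlongrightarrow> Lm) at_top" and
      E: "mittag_leffler \<rho> \<mu> z = \<kappa> * Lp - \<kappa> * Lm"
      using mittag_leffler_eq_jump[OF assms z] unfolding q_def \<kappa>_def by metis
    have "((\<lambda>x. \<Phi> (Complex x (Arg2pi z))) \<longlongrightarrow> Lp) at_top"
      by (rule Lp) (use \<delta> arg q(3) in linarith)+
    note upper = indented_upper_ray_integrals[OF z \<epsilon> \<Phi> L0 this, folded \<kappa>_def]
    have "((\<lambda>x. \<Phi> (Complex x (Arg2pi z - 2 * pi))) \<longlongrightarrow> Lm) at_top"
      by (rule Lm) (use \<delta> arg q(3) in linarith)+
    note lower = indented_lower_ray_integrals[OF z \<epsilon> \<Phi> L0 this, folded \<kappa>_def]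
    have K3: "((\<lambda>r. ml_K3 \<rho> \<mu> r pi z) has_integral (I - J)) S"
      if "((\<lambda>r. ml_K' \<rho> \<mu> r pi z) has_integral I) S" "((\<lambda>r. ml_K' \<rho> \<mu> r (- pi) z) has_integral J) S" for I J S
      unfolding ml_K3_eq_diff using that by (rule has_integral_diff)
    show "(\<lambda>r. ml_K3 \<rho> \<mu> r pi z) integrable_on {0<..1 - \<epsilon>}"
      "(\<lambda>r. ml_K3 \<rho> \<mu> r pi z) integrable_on {1 + \<epsilon>..}"
      "(\<lambda>\<psi>. ml_P' \<rho> \<mu> \<epsilon> \<psi> 0 z) integrable_on {- pi..0}"
      "(\<lambda>\<psi>. ml_P' \<rho> \<mu> \<epsilon> \<psi> (- 2) z) integrable_on {- 2 * pi..- pi}"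
      "mittag_leffler \<rho> \<mu> z =
             integral {0<..1 - \<epsilon>} (\<lambda>r. ml_K3 \<rho> \<mu> r pi z)
             + integral {1 + \<epsilon>..} (\<lambda>r. ml_K3 \<rho> \<mu> r pi z)
             + integral {- pi..0} (\<lambda>\<psi>. ml_P' \<rho> \<mu> \<epsilon> \<psi> 0 z)
             + integral {- 2 * pi..- pi} (\<lambda>\<psi>. ml_P' \<rho> \<mu> \<epsilon> \<psi> (- 2) z)"
      using K3[OF upper(1) lower(1)] K3[OF upper(2) lower(2)] upper(3) lower(3) by (auto simp: has_integral_iff E)
  }
qed

end
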